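(* Let $B$ be a standard real Brownian motion and $X_t=\int_0^th(t-s)\,dB_s$, $t\in[0,1]$, where $h:(0,1]\to[0,+\infty)$ is square integrable, $h\in RV_{-1/2}$, and $h^2$ is non increasing. Let $H_2(t)=\int_0^th^2(s)\,ds$ and assume that $\eta=\sqrt{H_2}$ satisfies Fernique's condition $$\int_*^{+\infty}\eta(\mathrm e^{-x^2})\,dx<+\infty.$$ Then the family of small time processes $(X^\varepsilon)_\varepsilon$, $X^\varepsilon=(X_{\varepsilon t})_{t\in[0,1]}$, is not exponentially tight at speed $H_2^{-1}$ and does not satisfy an LDP on $\mathcal C([0,1],\mathbb R)$ as $\varepsilon\to0$ at speed $g=H_2^{-1}$.
   Context: $RV_\beta$ is the class of functions $\lambda$, positive near $0$, regularly varying at $0$ with index $\beta$: $\lim_{\varepsilon\to0+}\lambda(\varepsilon t)/\lambda(\varepsilon)=t^\beta$ for every $t>0$. In Fernique's condition $*$ denotes an unspecified constant (only convergence at $+\infty$ matters); under these assumptions $X$ has a continuous version, which is the one considered. $\mathcal C([0,1],\mathbb R)$ carries the supremum norm. A rate function on a topological space $E$ is a lower semicontinuous $I:E\to[0,+\infty]$ with compact level sets $\{I\le a\}$, $a\ge0$. A family of $E$-valued random variables with laws $(\mu_\varepsilon)_\varepsilon$ satisfies a Large Deviations Principle (LDP) as $\varepsilon\to0$ with speed $g$ (where $g(\varepsilon)\to+\infty$) and rate function $I$ if $\limsup_{\varepsilon\to0}\frac1{g(\varepsilon)}\log\mu_\varepsilon(F)\le-\inf_FI$ for every closed $F\subset E$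 and $\liminf_{\varepsilon\to0}\frac1{g(\varepsilon)}\log\mu_\varepsilon(G)\ge-\inf_GI$ for every open $G\subset E$. "Satisfies an LDP at speed $g$" means: with some rate function. The family is exponentially tight at speed $g$ (as $\varepsilon\to0$) if for every $R>0$ there is a compact set $K_R\subset E$ with $\mu_\varepsilon(E\setminus K_R)<\mathrm e^{-g(\varepsilon)R}$ for all sufficiently small $\varepsilon>0$. *)

theory Defs
  imports "HOL-Probability.Probability"
begin

definition regularly_varying_at_0 :: "real \<Rightarrow> (real \<Rightarrow> real) \<Rightarrow> bool" where
  "regularly_varying_at_0 \<beta> f \<longleftrightarrow>
     (\<forall>\<^sub>F \<epsilon> in at_right 0. 0 < f \<epsilon>) \<and>
     (\<forall>t>0. ((\<lambda>\<epsilon>. f (\<epsilon> * t) / f \<epsilon>) \<longlongrightarrow> t powr \<beta>) (at_right 0))"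

(* Meant for \<eta> \<ge> 0, so that integrability is the same as finiteness of the integral. *)
definition fernique_condition :: "(real \<Rightarrow> real) \<Rightarrow> bool" where
  "fernique_condition \<eta> \<longleftrightarrow>
     (\<exists>a. set_integrable lborel {a..} (\<lambda>x. \<eta> (exp (- (x\<^sup>2)))))"

definition standard_brownian_motion :: "'a measure \<Rightarrow> (real \<Rightarrow> 'a \<Rightarrow> real) \<Rightarrow> bool" where
  "standard_brownian_motion M B \<longleftrightarrow>
     (\<forall>t\<ge>0. B t \<in> borel_measurable M) \<and>
     (AE \<omega> in M. B 0 \<omega> = 0) \<and>
     (AE \<omega> in M. continuous_on {0..} (\<lambda>t. B t \<omega>)) \<and>
     (\<forall>s t. 0 \<le> s \<and> s < t \<longrightarrow>
        distributed M lborel (\<lambda>\<omega>. B t \<omega> - B s \<omega>) (normal_density 0 (sqrt (t - s)))) \<and>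
     (\<forall>(u :: nat \<Rightarrow> real) n. 0 \<le> u 0 \<and> (\<forall>i<n. u i < u (Suc i)) \<longrightarrow>
        prob_space.indep_vars M (\<lambda>_. borel) (\<lambda>i \<omega>. B (u (Suc i)) \<omega> - B (u i) \<omega>) {..<n})"

(* A list of triples (c, a, b) stands for the step function
   \<Sum> c * indicator {a<..b} and for its integral \<Sum> c * (B b - B a). *)
definition step_function :: "(real \<times> real \<times> real) list \<Rightarrow> real \<Rightarrow> real" where
  "step_function P x = (\<Sum>(c, a, b)\<leftarrow>P. c * indicator {a<..b} x)"

definition step_integral ::
  "(real \<Rightarrow> 'a \<Rightarrow> real) \<Rightarrow> (real \<times> real \<times> real) list \<Rightarrow> 'a \<Rightarrow> real" where
  "step_integral B P \<omega> = (\<Sum>(c, a, b)\<leftarrow>P. c * (B b \<omega> - B a \<omega>))"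

(* Y is a version of the integral of f against dB over [0,T]: the L2(M)-limit of the
   integrals of step functions converging to f in L2([0,T]).  Meant for f measurable
   and square integrable on [0,T]; Y is then determined up to a null set.
   Values of f on Lebesgue-null sets are irrelevant. *)
definition is_wiener_integral ::
  "'a measure \<Rightarrow> (real \<Rightarrow> 'a \<Rightarrow> real) \<Rightarrow> real \<Rightarrow> (real \<Rightarrow> real) \<Rightarrow> ('a \<Rightarrow> real) \<Rightarrow> bool" where
  "is_wiener_integral M B T f Y \<longleftrightarrow>
     Y \<in> borel_measurable M \<and>
     (\<exists>P. (\<forall>k. \<forall>(c, a, b) \<in> set (P k). 0 \<le> a \<and> a \<le> b \<and> b \<le> T) \<and>
          (\<lambda>k. \<integral>\<^sup>+x\<in>{0..T}. ennreal ((f x - step_function (P k) x)\<^sup>2) \<partial>lborel) \<longlonglongrightarrow> 0 \<and>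
          (\<lambda>k. \<integral>\<^sup>+\<omega>. ennreal ((Y \<omega> - step_integral B (P k) \<omega>)\<^sup>2) \<partial>M) \<longlonglongrightarrow> 0)"

definition borel_of :: "'e topology \<Rightarrow> 'e measure" where
  "borel_of E = sigma (topspace E) {U. openin E U}"

definition ext_ln :: "real \<Rightarrow> ereal" where
  "ext_ln x = (if x \<le> 0 then - \<infinity> else ereal (ln x))"

definition rate_function :: "'e topology \<Rightarrow> ('e \<Rightarrow> ennreal) \<Rightarrow> bool" where
  "rate_function E I \<longleftrightarrow>
     (\<forall>a. openin E {x \<in> topspace E. a < I x}) \<and>
     (\<forall>a\<ge>0. compactin E {x \<in> topspace E. I x \<le> ennreal a})"

(* That the speed g tends to infinity is not part of the two notions below. *)
definition LDP_with ::
  "'e topology \<Rightarrow> (real \<Rightarrow> 'e measure) \<Rightarrow> (real \<Rightarrow> real) \<Rightarrow> ('e \<Rightarrow> ennreal) \<Rightarrow> bool" where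
  "LDP_with E \<mu> g I \<longleftrightarrow>
     rate_function E I \<and>
     (\<forall>F. closedin E F \<longrightarrow>
        Limsup (at_right 0) (\<lambda>\<epsilon>. ereal (1 / g \<epsilon>) * ext_ln (measure (\<mu> \<epsilon>) F))
          \<le> - enn2ereal (INF x\<in>F. I x)) \<and>
     (\<forall>G. openin E G \<longrightarrow>
        - enn2ereal (INF x\<in>G. I x)
          \<le> Liminf (at_right 0) (\<lambda>\<epsilon>. ereal (1 / g \<epsilon>) * ext_ln (measure (\<mu> \<epsilon>) G)))"

definition satisfies_LDP ::
  "'e topology \<Rightarrow> (real \<Rightarrow> 'e measure) \<Rightarrow> (real \<Rightarrow> real) \<Rightarrow> bool" where
  "satisfies_LDP E \<mu> g \<longleftrightarrow> (\<exists>I. LDP_with E \<mu> g I)"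

definition exponentially_tight ::
  "'e topology \<Rightarrow> (real \<Rightarrow> 'e measure) \<Rightarrow> (real \<Rightarrow> real) \<Rightarrow> bool" where
  "exponentially_tight E \<mu> g \<longleftrightarrow>
     (\<forall>R>0. \<exists>K. compactin E K \<and>
        (\<forall>\<^sub>F \<epsilon> in at_right 0. measure (\<mu> \<epsilon>) (topspace E - K) < exp (- (g \<epsilon> * R))))"

(* Elements of cfunspace are extensional functions, hence the restrict in small_time. *)
abbreviation C01 :: "(real \<Rightarrow> real) topology" where
  "C01 \<equiv> mtopology_of (cfunspace (top_of_set {0..1}) euclidean_metric)"

definition small_time :: "(real \<Rightarrow> 'a \<Rightarrow> real) \<Rightarrow> real \<Rightarrow> 'a \<Rightarrow> (real \<Rightarrow> real)" where
  "small_time X \<epsilon> \<omega> = restrict (\<lambda>t. X (\<epsilon> * t) \<omega>) {0..1}"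

definition small_time_law :: "'a measure \<Rightarrow> (real \<Rightarrow> 'a \<Rightarrow> real) \<Rightarrow> real \<Rightarrow> (real \<Rightarrow> real) measure" where
  "small_time_law M X \<epsilon> = distr M (borel_of C01) (small_time X \<epsilon>)"

end

theory Submission
  imports Defs
begin

text \<open>
  Since \<open>h\<^sup>2\<close> is regularly varying with index \<open>-1\<close>, the variance \<open>H\<^sub>2\<close> of \<open>X\<close> is slowly varying: for
  every fixed \<open>\<delta>\<close>, the increment of the path \<open>X\<^sup>\<epsilon>\<close> over \<open>[0, \<delta>]\<close> is a centered Gaussian
  variable of variance \<open>H\<^sub>2 (\<epsilon> \<delta>) \<ge> H\<^sub>2 \<epsilon> / 2\<close>, hence exceeds 1 with probability at least
  \<open>exp (- 8 / H\<^sub>2 \<epsilon>)\<close>, with a constant that does not depend on \<open>\<delta>\<close>. A compact set of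
  continuous functions is equicontinuous at 0, so for \<open>\<delta>\<close> small it contains no function with
  such an increment. This contradicts exponential tightness directly; and it contradicts the upper
  bound of an LDP when the compact set is a level set of the rate function.
\<close>

section \<open>Integrals of step functions\<close>

lemma strict_mono_enumeration:
  fixes U :: "real set"
  assumes "finite U" "U \<noteq> {}"
  obtains u :: "nat \<Rightarrow> real" and n where "u ` {..n} = U" "strict_mono_on {..n} u"
proof -
  let ?us = "sorted_list_of_set U"
  have len: "length ?us = card U" "card U > 0" using assms by (auto simp: card_gt_0_iff)
  have eq: "{..card U - 1} = {..<card U}" using len(2) by auto
  have "(!) ?us ` {..card U - 1} = U"
    using assms(1) len unfolding eq
    by (metis lessThan_atLeast0 list.set_map map_nth set_sorted_list_of_set set_upt)
  moreover have "strict_mono_on {..card U - 1} ((!) ?us)"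
    unfolding eq using len(1) strict_sorted_list_of_set[of U]
    by (auto intro!: strict_mono_onI simp: sorted_wrt_iff_nth_less)
  ultimately show ?thesis by (rule that)
qed

text \<open>The sorted endpoints split the intervals of \<open>P\<close> into consecutive cells,
  over which Brownian increments are independent. Since the grid and the coefficients do not depend
  on \<open>F\<close>, the same ones serve the step function and its stochastic integral.\<close>

lemma common_refinement:
  fixes P :: "(real \<times> real \<times> real) list"
  assumes P: "\<forall>(c, a, b)\<in>set P. 0 \<le> a \<and> a \<le> b \<and> b \<le> T" and T: "0 \<le> T"
  obtains u :: "nat \<Rightarrow> real" and n d where
    "0 \<le> u 0" "\<And>i. i < n \<Longrightarrow> u i < u (Suc i)" "u n \<le> T"
    "\<And>F :: real \<Rightarrow> real. (\<Sum>(c, a, b)\<leftarrow>P. c * (F b - F a)) = (\<Sum>i<n. d i * (F (u (Suc i)) - F (u i)))"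
proof -
  \<comment> \<open>Including 0 keeps the grid nonempty even for an empty \<open>P\<close>; it stays
    inside \<open>{0..T}\<close> because \<open>0 \<le> T\<close>.\<close>
  define U where "U = insert 0 ((\<lambda>(c, a, b). a) ` set P \<union> (\<lambda>(c, a, b). b) ` set P)"
  have "finite U" "U \<noteq> {}" by (auto simp: U_def)
  then obtain u :: "nat \<Rightarrow> real" and n where u: "u ` {..n} = U" "strict_mono_on {..n} u"
    using strict_mono_enumeration[of U] by blast
  have U: "U \<subseteq> {0..T}" using P T by (fastforce simp: U_def)
  have le: "u i \<le> u j \<longleftrightarrow> i \<le> j" if "i \<le> n" "j \<le> n" for i j
    using strict_mono_on_less_eq[OF u(2)] that by simp
  \<comment> \<open>The coefficient of a cell is the total weight of the intervals that contain it.
    Every endpoint is a grid point, so each interval is a union of whole cells and its increment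
    telescopes.\<close>
  define d where "d i = (\<Sum>(c, a, b)\<leftarrow>P. if a \<le> u i \<and> u (Suc i) \<le> b then c else 0)" for i
  have incr: "F b - F a = (\<Sum>i<n. if a \<le> u i \<and> u (Suc i) \<le> b then F (u (Suc i)) - F (u i) else 0)"
    if "(c, a, b) \<in> set P" for a b c and F :: "real \<Rightarrow> real"
  proof -
    from that have "a \<in> U" "b \<in> U" by (force simp: U_def)+
    then obtain j k where jk: "j \<le> n" "k \<le> n" "a = u j" "b = u k" using u(1) by fastforce
    have "j \<le> k" using P that le[of j k] jk by auto
    have "(\<Sum>i<n. if a \<le> u i \<and> u (Suc i) \<le> b then F (u (Suc i)) - F (u i) else 0) =
          (\<Sum>i\<in>{j..<k}. F (u (Suc i)) - F (u i))"
      using jk by (intro sum.mono_neutral_cong_right) (auto simp: le Suc_le_eq)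
    also have "\<dots> = F b - F a"
      using sum_Suc_diff'[OF \<open>j \<le> k\<close>, of "\<lambda>i. F (u i)"] jk by simp
    finally show ?thesis by simp
  qed
  have "(\<Sum>(c, a, b)\<leftarrow>P. c * (F b - F a)) = (\<Sum>i<n. d i * (F (u (Suc i)) - F (u i)))" for F
  proof -
    have "(\<Sum>(c, a, b)\<leftarrow>P. c * (F b - F a)) =
        (\<Sum>(c, a, b)\<leftarrow>P. \<Sum>i<n. (if a \<le> u i \<and> u (Suc i) \<le> b then c else 0) * (F (u (Suc i)) - F (u i)))"
      by (intro arg_cong[where f = sum_list] map_cong refl)
         (auto simp: incr[where F = F] sum_distrib_left intro!: sum.cong)
    also have "\<dots> = (\<Sum>i<n. d i * (F (u (Suc i)) - F (u i)))"
      unfolding d_def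
      by (induction P) (auto simp: sum.distrib distrib_right)
    finally show ?thesis .
  qed
  moreover have "0 \<le> u 0" "u n \<le> T" using u(1) U by (auto simp: image_subset_iff)
  moreover have "u i < u (Suc i)" if "i < n" for i
    using strict_mono_onD[OF u(2)] that by simp
  ultimately show ?thesis using that by blast
qed

text \<open>For fixed \<open>x\<close>, the indicator of \<open>{a<..b}\<close> at \<open>x\<close>
  is the increment from \<open>a\<close> to \<open>b\<close> of the function
  \<open>indicator {x..}\<close>. This is the shape handled by
  \<open>common_refinement\<close>.\<close>

lemma step_function_eq:
  assumes "\<forall>(c, a, b)\<in>set P. a \<le> b"
  shows "step_function P x = (\<Sum>(c, a, b)\<leftarrow>P. c * (indicator {x..} b - indicator {x..} a))"
  unfolding step_function_def using assms
  by (intro arg_cong[where f = sum_list] map_cong refl) (auto simp: indicator_def)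

lemma step_function_measurable [measurable]: "step_function P \<in> borel_measurable borel"
  unfolding step_function_def by (induction P) auto

lemma step_integral_measurable:
  assumes "\<And>t. 0 \<le> t \<Longrightarrow> B t \<in> borel_measurable M"
    and "\<forall>(c, a, b)\<in>set P. 0 \<le> a \<and> a \<le> b \<and> b \<le> T"
  shows "step_integral B P \<in> borel_measurable M"
  using assms(2) unfolding step_integral_def
proof (induction P)
  case (Cons p P)
  obtain c a b where "p = (c, a, b)" by (cases p) auto
  with Cons assms(1)[of a] assms(1)[of b] show ?case by simp
qed simp

text \<open>The cells are pairwise disjoint, so only the diagonal terms of the squared sum survive.
  The resulting sum is also the variance of the matching combination of Brownian increments: this is
  the isometry for step functions.\<close>

lemma step_function_square_integral:
  fixes u d f :: "_ \<Rightarrow> real"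
  assumes u: "0 \<le> u 0" "\<And>i. i < n \<Longrightarrow> u i < u (Suc i)" "u n \<le> T"
    and f: "\<And>x. f x = (\<Sum>i<n. d i * (indicator {x..} (u (Suc i)) - indicator {x..} (u i)))"
  shows "integrable lborel (\<lambda>x. indicator {0..T} x * (f x)\<^sup>2)"
    "(LINT x|lborel. indicator {0..T} x * (f x)\<^sup>2) = (\<Sum>i<n. (d i)\<^sup>2 * (u (Suc i) - u i))"
proof -
  have mono: "u i \<le> u j" if "i \<le> j" "j \<le> n" for i j
    using that
  proof (induction j rule: dec_induct)
    case (step m)
    then show ?case using u(2)[of m] by simp
  qed simp
  define a where "a i x = d i * indicator {u i<..u (Suc i)} x" for i x
  have fa: "f x = (\<Sum>i<n. a i x)" for x
    unfolding f a_def using u(2) by (intro sum.cong refl) (force simp: indicator_def)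
  have disj: "a i x * a j x = 0" if "i < n" "j < n" "i \<noteq> j" for i j x
    using that
  proof (induction i j rule: linorder_wlog)
    case (le i j)
    then have "u (Suc i) \<le> u j" by (intro mono) auto
    then show ?case by (auto simp: a_def indicator_def)
  qed (simp add: mult.commute)
  have sq: "(f x)\<^sup>2 = (\<Sum>i<n. (d i)\<^sup>2 * indicator {u i<..u (Suc i)} x)" for x
  proof -
    have "(f x)\<^sup>2 = (\<Sum>i<n. \<Sum>j<n. a i x * a j x)"
      by (simp add: fa power2_eq_square sum_product)
    also have "\<dots> = (\<Sum>i<n. \<Sum>j<n. if j = i then a i x * a i x else 0)"
      by (intro sum.cong refl) (auto simp: disj)
    also have "\<dots> = (\<Sum>i<n. a i x * a i x)" by simp
    also have "\<dots> = (\<Sum>i<n. (d i)\<^sup>2 * indicator {u i<..u (Suc i)} x)"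
      by (intro sum.cong refl) (simp add: a_def power2_eq_square indicator_def)
    finally show ?thesis .
  qed
  have ind: "indicator {0..T} x * indicator {u i<..u (Suc i)} x = (indicator {u i<..u (Suc i)} x :: real)"
    if "i < n" for i x
    using mono[of 0 i] mono[of "Suc i" n] u that by (auto simp: indicator_def)
  have eq: "(\<lambda>x. indicator {0..T} x * (f x)\<^sup>2) =
      (\<lambda>x. \<Sum>i<n. (d i)\<^sup>2 * indicator {u i<..u (Suc i)} x)"
    unfolding sq sum_distrib_left mult.left_commute[of "indicator {0..T} _"]
    by (intro ext sum.cong refl) (simp only: ind lessThan_iff)
  have int: "integrable lborel (\<lambda>x. (d i)\<^sup>2 * indicator {u i<..u (Suc i)} x)" if "i \<in> {..<n}" for i
    using u(2)[of i] that by (intro integrable_mult_right integrable_real_indicator) auto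
  show "integrable lborel (\<lambda>x. indicator {0..T} x * (f x)\<^sup>2)"
    unfolding eq by (intro Bochner_Integration.integrable_sum int)
  have "(LINT x|lborel. (\<Sum>i<n. (d i)\<^sup>2 * indicator {u i<..u (Suc i)} x)) =
      (\<Sum>i<n. (LINT x|lborel. (d i)\<^sup>2 * indicator {u i<..u (Suc i)} x))"
    by (rule Bochner_Integration.integral_sum) (rule int)
  also have "\<dots> = (\<Sum>i<n. (d i)\<^sup>2 * (u (Suc i) - u i))"
    using u(2) by (intro sum.cong refl) (simp add: less_imp_le)
  finally show "(LINT x|lborel. indicator {0..T} x * (f x)\<^sup>2) = (\<Sum>i<n. (d i)\<^sup>2 * (u (Suc i) - u i))"
    unfolding eq .
qed

text \<open>Characteristic functions are used instead of densities because they also cover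
  \<open>c = 0\<close>, where the law is a point mass. The claim is the standard normal formula at
  the argument \<open>\<theta> * c * \<sigma>\<close>.\<close>

lemma (in prob_space) char_cmult_normal:
  assumes Z: "distributed M lborel Z (normal_density 0 \<sigma>)" and \<sigma>: "0 < \<sigma>"
  shows "char (distr M borel (\<lambda>\<omega>. c * Z \<omega>)) \<theta> = exp (- (\<theta>\<^sup>2 * (c\<^sup>2 * \<sigma>\<^sup>2)) / 2)"
proof -
  have Zm [measurable]: "Z \<in> borel_measurable M"
    using distributed_measurable[OF Z] by simp
  have std: "distributed M lborel (\<lambda>x. (Z x - 0) / \<sigma>) std_normal_density"
    using normal_standard_normal_convert[OF \<sigma>, of Z 0] Z by simp
  have "distr M borel (\<lambda>x. Z x / \<sigma>) = distr M lborel (\<lambda>x. Z x / \<sigma>)"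
    by (intro distr_cong) auto
  also have "\<dots> = std_normal_distribution"
    using distributed_distr_eq_density[OF std] by simp
  finally have eq: "distr M borel (\<lambda>x. Z x / \<sigma>) = std_normal_distribution" .
  have "char (distr M borel (\<lambda>\<omega>. c * Z \<omega>)) \<theta> = char (distr M borel (\<lambda>x. Z x / \<sigma>)) (\<theta> * c * \<sigma>)"
    using \<sigma> by (simp add: char_def integral_distr mult.assoc)
  also have "\<dots> = exp (- (\<theta>\<^sup>2 * (c\<^sup>2 * \<sigma>\<^sup>2)) / 2)"
    unfolding eq char_std_normal_distribution by (simp add: power_mult_distrib mult.assoc)
  finally show ?thesis .
qed

text \<open>Along a common refinement the integral is a sum of independent Gaussian variables, so
  its characteristic function is a product of Gaussian ones and the variances add up.\<close>

lemma char_step_integral: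
  assumes "prob_space M" and B: "standard_brownian_motion M B"
    and P: "\<forall>(c, a, b)\<in>set P. 0 \<le> a \<and> a \<le> b \<and> b \<le> T" and T: "0 \<le> T"
  shows "integrable lborel (\<lambda>x. indicator {0..T} x * (step_function P x)\<^sup>2)"
    and "char (distr M borel (step_integral B P)) \<theta> =
      exp (- (\<theta>\<^sup>2 * (LINT x|lborel. indicator {0..T} x * (step_function P x)\<^sup>2)) / 2)"
proof -
  interpret prob_space M by fact
  obtain u n d where u: "0 \<le> u 0" "\<And>i. i < n \<Longrightarrow> u i < u (Suc i)" "u n \<le> T" and
    ref: "\<And>F :: real \<Rightarrow> real. (\<Sum>(c, a, b)\<leftarrow>P. c * (F b - F a)) = (\<Sum>i<n. d i * (F (u (Suc i)) - F (u i)))"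
    using common_refinement[OF P T] by blast
  have "step_function P x = (\<Sum>i<n. d i * (indicator {x..} (u (Suc i)) - indicator {x..} (u i)))" for x
    using P by (subst step_function_eq) (auto simp: ref[of "indicator {x..}"])
  note sq = step_function_square_integral[OF u this, simplified]
  show "integrable lborel (\<lambda>x. indicator {0..T} x * (step_function P x)\<^sup>2)"
    by (rule sq)
  let ?D = "\<lambda>i \<omega>. B (u (Suc i)) \<omega> - B (u i) \<omega>"
  have nonneg: "0 \<le> u i" if "i \<le> n" for i
    using that
  proof (induction i)
    case (Suc i)
    then show ?case using u(2)[of i] by simp
  qed (use u in simp)
  have indep: "indep_vars (\<lambda>_. borel) ?D {..<n}"
    using B u unfolding standard_brownian_motion_def by blast
  then have indep: "indep_vars (\<lambda>_. borel) (\<lambda>i \<omega>. d i * ?D i \<omega>) {..<n}"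
    by (rule indep_vars_compose2[where Y = "\<lambda>i x. d i * x"]) auto
  have "char (distr M borel (\<lambda>\<omega>. d i * ?D i \<omega>)) \<theta> = exp (- (\<theta>\<^sup>2 * ((d i)\<^sup>2 * (u (Suc i) - u i))) / 2)"
    if "i < n" for i
  proof -
    have "distributed M lborel (?D i) (normal_density 0 (sqrt (u (Suc i) - u i)))"
      using B nonneg[of i] u(2)[OF that] that unfolding standard_brownian_motion_def by simp
    from char_cmult_normal[OF this] show ?thesis using u(2)[OF that] by simp
  qed
  then have "char (distr M borel (\<lambda>\<omega>. \<Sum>i<n. d i * ?D i \<omega>)) \<theta> =
      (\<Prod>i<n. of_real (exp (- (\<theta>\<^sup>2 * ((d i)\<^sup>2 * (u (Suc i) - u i))) / 2)))"
    unfolding char_distr_sum[OF indep] by simp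
  also have "\<dots> = of_real (exp (\<Sum>i<n. - (\<theta>\<^sup>2 * ((d i)\<^sup>2 * (u (Suc i) - u i))) / 2))"
    by (simp add: exp_sum)
  also have "(\<Sum>i<n. - (\<theta>\<^sup>2 * ((d i)\<^sup>2 * (u (Suc i) - u i))) / 2) =
      - (\<theta>\<^sup>2 * (\<Sum>i<n. (d i)\<^sup>2 * (u (Suc i) - u i))) / 2"
    by (simp add: sum_distrib_left sum_negf sum_divide_distrib)
  \<comment> \<open>The refinement identity \<open>ref\<close> was applied to
    \<open>indicator {x..}\<close> for the step function; here \<open>F\<close> is a Brownian
    path.\<close>
  also have "(\<lambda>\<omega>. \<Sum>i<n. d i * ?D i \<omega>) = step_integral B P"
    unfolding step_integral_def fun_eq_iff using ref[of "\<lambda>t. B t _"] by simp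
  finally show "char (distr M borel (step_integral B P)) \<theta> =
      exp (- (\<theta>\<^sup>2 * (LINT x|lborel. indicator {0..T} x * (step_function P x)\<^sup>2)) / 2)"
    by (simp add: sq)
qed

section \<open>Convergence in mean square\<close>

text \<open>A weighted arithmetic-geometric mean inequality. The weight is free: a small
  \<open>\<eta>\<close> handles the second term, after which mean square convergence handles the
  first despite its large factor.\<close>

lemma abs_square_diff_le:
  fixes s f :: real
  assumes "0 < \<eta>"
  shows "\<bar>s\<^sup>2 - f\<^sup>2\<bar> \<le> (1 + 1 / \<eta>) * (f - s)\<^sup>2 + \<eta> * f\<^sup>2"
proof -
  have "2 * \<bar>f\<bar> * \<bar>f - s\<bar> \<le> (f - s)\<^sup>2 / \<eta> + \<eta> * f\<^sup>2"
  proof -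
    have "0 \<le> (\<bar>f - s\<bar> / sqrt \<eta> - sqrt \<eta> * \<bar>f\<bar>)\<^sup>2" by simp
    also have "\<dots> = (f - s)\<^sup>2 / \<eta> + \<eta> * f\<^sup>2 - 2 * \<bar>f\<bar> * \<bar>f - s\<bar>"
      using assms by (simp add: power2_diff power_divide power_mult_distrib)
    finally show ?thesis by simp
  qed
  moreover have "\<bar>s\<^sup>2 - f\<^sup>2\<bar> \<le> (f - s)\<^sup>2 + 2 * \<bar>f\<bar> * \<bar>f - s\<bar>"
  proof -
    have "s\<^sup>2 - f\<^sup>2 = (f - s)\<^sup>2 - 2 * (f * (f - s))" by (simp add: power2_eq_square algebra_simps)
    then have "\<bar>s\<^sup>2 - f\<^sup>2\<bar> \<le> \<bar>(f - s)\<^sup>2\<bar> + \<bar>2 * (f * (f - s))\<bar>" by linarith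
    then show ?thesis by (simp add: abs_mult)
  qed
  ultimately show ?thesis by (simp add: algebra_simps)
qed

lemma L2_convergence_integral_square:
  fixes f :: "'a \<Rightarrow> real" and s :: "nat \<Rightarrow> 'a \<Rightarrow> real"
  assumes [measurable]: "f \<in> borel_measurable N" "\<And>k. s k \<in> borel_measurable N"
    and f: "integrable N (\<lambda>x. (f x)\<^sup>2)" and s: "\<And>k. integrable N (\<lambda>x. (s k x)\<^sup>2)"
    and lim: "(\<lambda>k. \<integral>\<^sup>+x. ennreal ((f x - s k x)\<^sup>2) \<partial>N) \<longlonglongrightarrow> 0"
  shows "(\<lambda>k. \<integral>x. (s k x)\<^sup>2 \<partial>N) \<longlonglongrightarrow> (\<integral>x. (f x)\<^sup>2 \<partial>N)"
proof -
  define e where "e k = (\<integral>x. (f x - s k x)\<^sup>2 \<partial>N)" for k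
  have int: "integrable N (\<lambda>x. (f x - s k x)\<^sup>2)" for k
  proof (rule Bochner_Integration.integrable_bound)
    show "integrable N (\<lambda>x. 2 * (f x)\<^sup>2 + 2 * (s k x)\<^sup>2)" using f s by auto
    have "(a - b)\<^sup>2 \<le> 2 * a\<^sup>2 + 2 * b\<^sup>2" for a b :: real
      using zero_le_power2[of "a + b"] by (simp add: power2_sum power2_diff)
    then show "AE x in N. norm ((f x - s k x)\<^sup>2) \<le> norm (2 * (f x)\<^sup>2 + 2 * (s k x)\<^sup>2)"
      by (auto intro!: AE_I2)
  qed simp
  have "(\<lambda>k. ennreal (e k)) \<longlonglongrightarrow> ennreal 0"
    using lim nn_integral_eq_integral[OF int] by (simp add: e_def)
  then have e: "e \<longlonglongrightarrow> 0"
    by (subst (asm) tendsto_ennreal_iff) (auto simp: e_def)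
  show ?thesis
  proof (rule LIMSEQ_I)
    fix r :: real assume r: "0 < r"
    define I where "I = (\<integral>x. (f x)\<^sup>2 \<partial>N)"
    have I: "0 \<le> I" by (simp add: I_def)
    \<comment> \<open>Chosen so that \<open>\<eta> * I\<close> stays below \<open>r / 2\<close>; the
      summand 1 avoids a division by zero when \<open>I = 0\<close>.\<close>
    define \<eta> where "\<eta> = r / (2 * (I + 1))"
    have \<eta>: "0 < \<eta>" "\<eta> * I < r / 2" using r I by (auto simp: \<eta>_def field_simps)
    have "(\<lambda>k. (1 + 1 / \<eta>) * e k) \<longlonglongrightarrow> 0" using tendsto_mult_right_zero[OF e] by simp
    then have "\<forall>\<^sub>F k in sequentially. (1 + 1 / \<eta>) * e k < r / 2"
      using r by (intro order_tendstoD) auto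
    then obtain k0 where k0: "\<And>k. k \<ge> k0 \<Longrightarrow> (1 + 1 / \<eta>) * e k < r / 2"
      by (auto simp: eventually_sequentially)
    have "norm ((\<integral>x. (s k x)\<^sup>2 \<partial>N) - (\<integral>x. (f x)\<^sup>2 \<partial>N)) < r" if "k \<ge> k0" for k
    proof -
      have "norm ((\<integral>x. (s k x)\<^sup>2 \<partial>N) - (\<integral>x. (f x)\<^sup>2 \<partial>N)) = norm (\<integral>x. (s k x)\<^sup>2 - (f x)\<^sup>2 \<partial>N)"
        using f s by simp
      also have "\<dots> \<le> (\<integral>x. \<bar>(s k x)\<^sup>2 - (f x)\<^sup>2\<bar> \<partial>N)"
        by (simp only: real_norm_def integral_abs_bound)
      also have "\<dots> \<le> (\<integral>x. (1 + 1 / \<eta>) * (f x - s k x)\<^sup>2 + \<eta> * (f x)\<^sup>2 \<partial>N)"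
        using f s int abs_square_diff_le[OF \<eta>(1)]
        by (intro integral_mono) auto
      also have "\<dots> = (1 + 1 / \<eta>) * e k + \<eta> * I"
        using f int by (simp add: e_def I_def)
      also have "\<dots> < r" using add_strict_mono[OF k0[OF that] \<eta>(2)] by simp
      finally show ?thesis .
    qed
    then show "\<exists>no. \<forall>k\<ge>no. norm ((\<integral>x. (s k x)\<^sup>2 \<partial>N) - (\<integral>x. (f x)\<^sup>2 \<partial>N)) < r"
      by blast
  qed
qed

lemma norm_iexp_diff_le: "norm (iexp a - iexp b) \<le> \<bar>a - b\<bar>"
proof -
  have "iexp a - iexp b = iexp b * (iexp (a - b) - 1)"
    by (simp add: algebra_simps exp_diff)
  then have "norm (iexp a - iexp b) = norm (iexp (a - b) - 1)"
    by (simp add: norm_mult)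
  also have "\<dots> \<le> \<bar>a - b\<bar>" using iexp_approx1[of "a - b" 0] by simp
  finally show ?thesis .
qed

text \<open>The map \<open>iexp\<close> is 1-Lipschitz, which bounds the difference by a first
  absolute moment; on a probability space this is at most the root of the second moment.\<close>

lemma (in prob_space) char_diff_le:
  fixes X Y :: "'a \<Rightarrow> real"
  assumes [measurable]: "X \<in> borel_measurable M" "Y \<in> borel_measurable M"
    and int: "integrable M (\<lambda>\<omega>. (X \<omega> - Y \<omega>)\<^sup>2)"
  shows "norm (char (distr M borel X) \<theta> - char (distr M borel Y) \<theta>)
    \<le> \<bar>\<theta>\<bar> * sqrt (\<integral>\<omega>. (X \<omega> - Y \<omega>)\<^sup>2 \<partial>M)"
proof -
  have int1: "integrable M (\<lambda>\<omega>. \<bar>X \<omega> - Y \<omega>\<bar>)"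
    using square_integrable_imp_integrable[of "\<lambda>\<omega>. \<bar>X \<omega> - Y \<omega>\<bar>"] int by simp
  have int2: "integrable M (\<lambda>\<omega>. iexp (\<theta> * Z \<omega>))" if "Z \<in> borel_measurable M" for Z
    using integrable_iexp[of "\<lambda>\<omega>. of_real (\<theta> * Z \<omega>)"] that by simp
  have "norm (char (distr M borel X) \<theta> - char (distr M borel Y) \<theta>)
      = norm (\<integral>\<omega>. iexp (\<theta> * X \<omega>) - iexp (\<theta> * Y \<omega>) \<partial>M)"
    unfolding char_def by (subst Bochner_Integration.integral_diff) (use int2[of X] int2[of Y] in \<open>auto simp: integral_distr\<close>)
  also have "\<dots> \<le> (\<integral>\<omega>. \<bar>\<theta>\<bar> * \<bar>X \<omega> - Y \<omega>\<bar> \<partial>M)"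
  proof (rule order_trans[OF integral_norm_bound], rule integral_mono)
    show "norm (iexp (\<theta> * X \<omega>) - iexp (\<theta> * Y \<omega>)) \<le> \<bar>\<theta>\<bar> * \<bar>X \<omega> - Y \<omega>\<bar>" for \<omega>
      using norm_iexp_diff_le[of "\<theta> * X \<omega>" "\<theta> * Y \<omega>"]
      by (simp flip: abs_mult add: right_diff_distrib)
  qed (use int1 int2 in auto)
  also have "\<dots> = \<bar>\<theta>\<bar> * (\<integral>\<omega>. \<bar>X \<omega> - Y \<omega>\<bar> \<partial>M)" by simp
  also have "(\<integral>\<omega>. \<bar>X \<omega> - Y \<omega>\<bar> \<partial>M) \<le> sqrt (\<integral>\<omega>. (X \<omega> - Y \<omega>)\<^sup>2 \<partial>M)"
  proof (rule real_le_rsqrt)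
    \<comment> \<open>Comparing the first and second moments amounts to the nonnegativity of a
      variance.\<close>
    have "0 \<le> variance (\<lambda>\<omega>. \<bar>X \<omega> - Y \<omega>\<bar>)" by (rule variance_positive)
    also have "\<dots> = (\<integral>\<omega>. (X \<omega> - Y \<omega>)\<^sup>2 \<partial>M) - (\<integral>\<omega>. \<bar>X \<omega> - Y \<omega>\<bar> \<partial>M)\<^sup>2"
      using int int1 by (subst variance_eq) auto
    finally show "(\<integral>\<omega>. \<bar>X \<omega> - Y \<omega>\<bar> \<partial>M)\<^sup>2 \<le> (\<integral>\<omega>. (X \<omega> - Y \<omega>)\<^sup>2 \<partial>M)" by simp
  qed
  finally show ?thesis by (simp add: mult_left_mono)
qed

lemma (in prob_space) L2_convergence_char:
  fixes Y :: "'a \<Rightarrow> real" and S :: "nat \<Rightarrow> 'a \<Rightarrow> real"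
  assumes [measurable]: "Y \<in> borel_measurable M" "\<And>k. S k \<in> borel_measurable M"
    and lim: "(\<lambda>k. \<integral>\<^sup>+\<omega>. ennreal ((Y \<omega> - S k \<omega>)\<^sup>2) \<partial>M) \<longlonglongrightarrow> 0"
  shows "(\<lambda>k. char (distr M borel (S k)) \<theta>) \<longlonglongrightarrow> char (distr M borel Y) \<theta>"
proof -
  define e where "e k = (\<integral>\<^sup>+\<omega>. ennreal ((Y \<omega> - S k \<omega>)\<^sup>2) \<partial>M)" for k
  \<comment> \<open>Finitely many of the mean squares may be infinite, so the real-valued estimate
    is available only eventually.\<close>
  have fin: "\<forall>\<^sub>F k in sequentially. e k < top"
    using lim unfolding e_def by (intro order_tendstoD) auto
  have e: "(\<lambda>k. enn2real (e k)) \<longlonglongrightarrow> 0"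
    using tendsto_enn2real[of e 0 sequentially] lim unfolding e_def[symmetric] by simp
  have "(\<lambda>k. \<bar>\<theta>\<bar> * sqrt (enn2real (e k))) \<longlonglongrightarrow> \<bar>\<theta>\<bar> * sqrt 0"
    by (intro tendsto_intros e)
  then have lim0: "(\<lambda>k. \<bar>\<theta>\<bar> * sqrt (enn2real (e k))) \<longlonglongrightarrow> 0" by simp
  have "\<forall>\<^sub>F k in sequentially. norm (char (distr M borel (S k)) \<theta> - char (distr M borel Y) \<theta>)
      \<le> \<bar>\<theta>\<bar> * sqrt (enn2real (e k))"
    using fin
  proof eventually_elim
    case (elim k)
    have int: "integrable M (\<lambda>\<omega>. (Y \<omega> - S k \<omega>)\<^sup>2)"
      using elim by (intro integrableI_bounded) (auto simp: e_def)
    have "e k = ennreal (\<integral>\<omega>. (Y \<omega> - S k \<omega>)\<^sup>2 \<partial>M)"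
      unfolding e_def by (rule nn_integral_eq_integral[OF int]) simp
    then show ?case
      using char_diff_le[of Y "S k" \<theta>] int by (simp add: norm_minus_commute)
  qed
  from Lim_null_comparison[OF this lim0] show ?thesis by (rule LIM_zero_cancel)
qed

section \<open>The law of the moving average\<close>

text \<open>The formula for step integrals passes to the limit: mean square convergence carries over
  both the characteristic functions and the variances. The Borel function \<open>g\<close> stands in
  for \<open>f\<close>, because a moving average prescribes its integrand only up to a null
  set.\<close>

lemma wiener_integral_char:
  assumes M: "prob_space M" and B: "standard_brownian_motion M B" and T: "0 \<le> T"
    and Y: "is_wiener_integral M B T f Y"
    and [measurable]: "g \<in> borel_measurable borel"
    and fg: "AE x in lborel. x \<in> {0..T} \<longrightarrow> f x = g x"
    and int: "integrable lborel (\<lambda>x. indicator {0..T} x * (g x)\<^sup>2)"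
  shows "char (distr M borel Y) \<theta> =
    exp (- (\<theta>\<^sup>2 * (LINT x|lborel. indicator {0..T} x * (g x)\<^sup>2)) / 2)"
proof -
  interpret prob_space M by fact
  let ?I = "\<lambda>f. \<lambda>x::real. indicator {0..T} x * (f x)\<^sup>2 :: real"
  obtain P where P: "\<And>k. \<forall>(c, a, b)\<in>set (P k). 0 \<le> a \<and> a \<le> b \<and> b \<le> T"
    and Pf: "(\<lambda>k. \<integral>\<^sup>+x\<in>{0..T}. ennreal ((f x - step_function (P k) x)\<^sup>2) \<partial>lborel) \<longlonglongrightarrow> 0"
    and PY: "(\<lambda>k. \<integral>\<^sup>+\<omega>. ennreal ((Y \<omega> - step_integral B (P k) \<omega>)\<^sup>2) \<partial>M) \<longlonglongrightarrow> 0"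
    and [measurable]: "Y \<in> borel_measurable M"
    using Y unfolding is_wiener_integral_def by blast
  have Bm: "\<And>t. 0 \<le> t \<Longrightarrow> B t \<in> borel_measurable M"
    using B unfolding standard_brownian_motion_def by blast
  note [measurable] = step_integral_measurable[OF Bm P]
  have sq: "indicator {0..T} x * y\<^sup>2 = (indicator {0..T} x * y)\<^sup>2" for x y :: real
    by (auto simp: indicator_def)
  have "(\<lambda>k. LINT x|lborel. (indicator {0..T} x * step_function (P k) x)\<^sup>2)
      \<longlonglongrightarrow> (LINT x|lborel. (indicator {0..T} x * g x)\<^sup>2)"
  proof (rule L2_convergence_integral_square)
    have "(\<integral>\<^sup>+x. ennreal ((indicator {0..T} x * g x - indicator {0..T} x * step_function (P k) x)\<^sup>2) \<partial>lborel)
      = (\<integral>\<^sup>+x\<in>{0..T}. ennreal ((f x - step_function (P k) x)\<^sup>2) \<partial>lborel)" for k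
      using fg by (intro nn_integral_cong_AE) (auto simp: indicator_def)
    then show "(\<lambda>k. \<integral>\<^sup>+x. ennreal ((indicator {0..T} x * g x - indicator {0..T} x * step_function (P k) x)\<^sup>2) \<partial>lborel)
      \<longlonglongrightarrow> 0"
      using Pf by simp
  qed (use int char_step_integral(1)[OF M B P T] in \<open>simp_all flip: sq\<close>)
  then have "(\<lambda>k. LINT x|lborel. ?I (step_function (P k)) x) \<longlonglongrightarrow> (LINT x|lborel. ?I g x)"
    by (simp flip: sq)
  then have "(\<lambda>k. complex_of_real (exp (- (\<theta>\<^sup>2 * (LINT x|lborel. ?I (step_function (P k)) x)) / 2)))
      \<longlonglongrightarrow> exp (- (\<theta>\<^sup>2 * (LINT x|lborel. ?I g x)) / 2)"
    by (intro tendsto_intros) auto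
  moreover have "(\<lambda>k. char (distr M borel (step_integral B (P k))) \<theta>) \<longlonglongrightarrow> char (distr M borel Y) \<theta>"
    using PY by (intro L2_convergence_char) auto
  ultimately show ?thesis
    unfolding char_step_integral(2)[OF M B P T] by (rule LIMSEQ_unique[symmetric])
qed

section \<open>Lower bounds for Gaussian tails\<close>

text \<open>On an interval of length \<open>x\<close> the density is at least
  \<open>exp (- 4 * x\<^sup>2) / x\<close>. The constant 4 is crude, but only the order of the
  exponent matters.\<close>

lemma std_normal_tail_lower_bound:
  assumes "1 \<le> x"
  shows "exp (- 4 * x\<^sup>2) \<le> measure std_normal_distribution {x..2 * x}"
proof -
  interpret prob_space std_normal_distribution by (rule prob_space_normal_density) simp
  have "ennreal (exp (- 4 * x\<^sup>2)) = ennreal (exp (- 4 * x\<^sup>2) / x) * emeasure lborel {x..2 * x}"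
    using assms by (simp flip: ennreal_mult)
  also have "\<dots> = (\<integral>\<^sup>+y. ennreal (exp (- 4 * x\<^sup>2) / x) * indicator {x..2 * x} y \<partial>lborel)"
    by (simp add: nn_integral_cmult_indicator)
  also have "\<dots> \<le> (\<integral>\<^sup>+y. ennreal (std_normal_density y) * indicator {x..2 * x} y \<partial>lborel)"
  proof (rule nn_integral_mono)
    fix y
    have "exp (- 4 * x\<^sup>2) / x \<le> std_normal_density y" if y: "x \<le> y" "y \<le> 2 * x"
    proof -
      \<comment> \<open>Half of the exponent \<open>4 * x\<^sup>2\<close> absorbs the normalizing
        constant, the other half dominates \<open>y\<^sup>2 / 2\<close> because
        \<open>y \<le> 2 * x\<close>.\<close>
      have "sqrt (2 * pi) \<le> sqrt (3\<^sup>2)" using pi_less_4 by (intro real_sqrt_le_mono) simp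
      also have "\<dots> \<le> exp 2" using exp_ge_add_one_self[of 2] by simp
      also have "\<dots> \<le> exp (2 * x\<^sup>2)" using assms by simp
      finally have "exp (- 2 * x\<^sup>2) \<le> 1 / sqrt (2 * pi)"
        by (simp add: exp_minus field_simps)
      moreover have "exp (- 2 * x\<^sup>2) \<le> exp (- y\<^sup>2 / 2)"
        using power_mono[OF y(2), of 2] assms y by (simp add: power_mult_distrib)
      ultimately have "exp (- 2 * x\<^sup>2) * exp (- 2 * x\<^sup>2) \<le> 1 / sqrt (2 * pi) * exp (- y\<^sup>2 / 2)"
        by (intro mult_mono) auto
      also have "\<dots> = std_normal_density y" by (simp add: std_normal_density_def)
      finally have "exp (- 4 * x\<^sup>2) \<le> std_normal_density y" by (simp flip: exp_add)
      moreover have "exp (- 4 * x\<^sup>2) / x \<le> exp (- 4 * x\<^sup>2)"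
        using assms by (simp add: divide_le_eq)
      ultimately show ?thesis by linarith
    qed
    then show "ennreal (exp (- 4 * x\<^sup>2) / x) * indicator {x..2 * x} y
      \<le> ennreal (std_normal_density y) * indicator {x..2 * x} y"
      by (auto simp: indicator_def intro!: ennreal_leI)
  qed
  also have "\<dots> = emeasure std_normal_distribution {x..2 * x}"
    by (simp add: emeasure_density)
  also have "\<dots> = ennreal (measure std_normal_distribution {x..2 * x})"
    by (rule emeasure_eq_measure)
  finally show ?thesis by simp
qed

text \<open>By uniqueness of characteristic functions, \<open>Y\<close> has the law of
  \<open>sqrt v\<close> times a standard normal variable. The bound \<open>v \<le> 1\<close> gives
  \<open>1 / sqrt v \<ge> 1\<close>, the range of the standard tail estimate.\<close>

lemma (in prob_space) centered_normal_tail_lower_bound: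
  assumes [measurable]: "Y \<in> borel_measurable M" and v: "0 < v" "v \<le> 1"
    and char: "\<And>\<theta>. char (distr M borel Y) \<theta> = exp (- (\<theta>\<^sup>2 * v) / 2)"
  shows "exp (- 4 / v) \<le> prob {\<omega> \<in> space M. 1 \<le> \<bar>Y \<omega>\<bar>}"
proof -
  let ?N = std_normal_distribution
  interpret N: real_distribution ?N by (rule real_dist_normal_dist)
  have law: "distr M borel Y = distr ?N borel (\<lambda>x. sqrt v * x)"
  proof (rule Levy_uniqueness)
    have "char (distr ?N borel (\<lambda>x. sqrt v * x)) \<theta> = char ?N (\<theta> * sqrt v)" for \<theta>
      by (simp add: char_def integral_distr mult.assoc)
    then show "char (distr M borel Y) = char (distr ?N borel (\<lambda>x. sqrt v * x))"
      using v by (simp add: fun_eq_iff char char_std_normal_distribution power_mult_distrib)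
  qed auto
  have "exp (- 4 / v) = exp (- 4 * (1 / sqrt v)\<^sup>2)" using v by (simp add: power_divide)
  also have "\<dots> \<le> measure ?N {1 / sqrt v..2 * (1 / sqrt v)}"
    using v by (intro std_normal_tail_lower_bound) simp
  also have "\<dots> \<le> measure ?N ((\<lambda>x. sqrt v * x) -` {y. 1 \<le> \<bar>y\<bar>} \<inter> space ?N)"
    using v by (intro N.finite_measure_mono) (auto simp: field_simps intro: order_trans[OF _ abs_ge_self])
  also have "\<dots> = measure (distr ?N borel (\<lambda>x. sqrt v * x)) {y. 1 \<le> \<bar>y\<bar>}"
    by (subst measure_distr) auto
  also have "\<dots> = measure (distr M borel Y) {y. 1 \<le> \<bar>y\<bar>}" by (simp only: law)
  also have "\<dots> = prob {\<omega> \<in> space M. 1 \<le> \<bar>Y \<omega>\<bar>}"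
    by (subst measure_distr) (auto intro!: arg_cong[where f = prob])
  finally show ?thesis .
qed

section \<open>The variance of the moving average and its behaviour near 0\<close>

lemma set_integrable_Ioc_mono:
  fixes f :: "real \<Rightarrow> real"
  assumes "set_integrable lborel {0<..r} f" "b \<le> r"
  shows "integrable lborel (\<lambda>s. indicator {0<..b} s * f s)"
  using set_integrable_subset[OF assms(1), of "{0<..b}"] assms(2)
  by (simp add: set_integrable_def Ioc_subset_iff)

text \<open>The reflection \<open>u = b - s\<close> turns the squared norm of the integrand into the
  integral of \<open>h\<^sup>2\<close> over \<open>{0<..b}\<close>.\<close>

lemma wiener_integral_moving_average_char:
  assumes M: "prob_space M" and B: "standard_brownian_motion M B" and b: "0 \<le> b" "b \<le> 1"
    and Y: "is_wiener_integral M B b (\<lambda>s. h (b - s)) Y"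
    and h: "set_borel_measurable lborel {0<..1} h" "set_integrable lborel {0<..1} (\<lambda>s. (h s)\<^sup>2)"
  shows "char (distr M borel Y) \<theta> = exp (- (\<theta>\<^sup>2 * (LINT s:{0<..b}|lborel. (h s)\<^sup>2)) / 2)"
proof -
  \<comment> \<open>The cut-off is Borel on the whole line. On \<open>{0..b}\<close> the functions
    \<open>h (b - s)\<close> and \<open>k (b - s)\<close> can differ only at \<open>s = b\<close>,
    where \<open>h 0\<close> is unspecified.\<close>
  define k where "k s = indicator {0<..1} s * h s" for s
  have [measurable]: "k \<in> borel_measurable borel"
    using h(1) by (simp add: set_borel_measurable_def k_def[abs_def])
  have k2: "indicator {0..b} (b - u) * (k u)\<^sup>2 = indicator {0<..b} u * (h u)\<^sup>2" for u
    using b by (auto simp: k_def indicator_def)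
  have int: "integrable lborel (\<lambda>u. indicator {0<..b} u * (h u)\<^sup>2)"
    by (rule set_integrable_Ioc_mono[OF h(2) b(2)])
  have "char (distr M borel Y) \<theta> =
      exp (- (\<theta>\<^sup>2 * (LINT s|lborel. indicator {0..b} s * (k (b - s))\<^sup>2)) / 2)"
  proof (rule wiener_integral_char[OF M B b(1) Y])
    show "AE s in lborel. s \<in> {0..b} \<longrightarrow> h (b - s) = k (b - s)"
      using AE_lborel_singleton[of b] by (rule AE_mp) (use b in \<open>auto simp: k_def indicator_def\<close>)
    show "integrable lborel (\<lambda>s. indicator {0..b} s * (k (b - s))\<^sup>2)"
      using lborel_integrable_real_affine[OF int, of "-1" b] k2[of "b - _"] by simp
  qed simp
  also have "(LINT s|lborel. indicator {0..b} s * (k (b - s))\<^sup>2) = (LINT u|lborel. indicator {0<..b} u * (h u)\<^sup>2)"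
    by (subst lborel_integral_real_affine[where c = "-1" and t = b]) (simp_all add: k2)
  finally show ?thesis by (simp add: set_lebesgue_integral_def)
qed

text \<open>Substituting \<open>s = u / \<delta>\<close> in the left-hand integral reduces the claim to the pointwise bound
  \<open>(h (u / \<delta>))\<^sup>2 \<le> 2 * \<delta> * (h u)\<^sup>2\<close> near 0.\<close>
lemma regularly_varying_integral_square_slowly_varying:
  fixes h :: "real \<Rightarrow> real"
  assumes rv: "regularly_varying_at_0 (- 1 / 2) h" and \<delta>: "0 < \<delta>" "\<delta> \<le> 1" and r: "0 < r"
    and int: "set_integrable lborel {0<..r} (\<lambda>s. (h s)\<^sup>2)"
  shows "\<forall>\<^sub>F \<epsilon> in at_right 0. (LINT s:{0<..\<epsilon>}|lborel. (h s)\<^sup>2) \<le> 2 * (LINT s:{0<..\<epsilon> * \<delta>}|lborel. (h s)\<^sup>2)"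
proof -
  \<comment> \<open>Regular variation is taken at the ratio \<open>1 / \<delta>\<close>. After
    squaring, the index is -1 and the limit is \<open>\<delta>\<close>; the factor 2 in the target
    bound is slack.\<close>
  have "((\<lambda>u. h (u * (1 / \<delta>)) / h u) \<longlongrightarrow> (1 / \<delta>) powr (- 1 / 2)) (at_right 0)"
    using rv \<delta> unfolding regularly_varying_at_0_def by (meson zero_less_divide_1_iff)
  then have "((\<lambda>u. (h (u * (1 / \<delta>)) / h u)\<^sup>2) \<longlongrightarrow> ((1 / \<delta>) powr (- 1 / 2))\<^sup>2) (at_right 0)"
    by (rule tendsto_power)
  also have "((1 / \<delta>) powr (- 1 / 2))\<^sup>2 = \<delta>"
    using \<delta> by (simp add: powr_divide powr_minus_divide powr_half_sqrt)
  finally have "\<forall>\<^sub>F u in at_right 0. (h (u * (1 / \<delta>)) / h u)\<^sup>2 < 2 * \<delta>"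
    by (rule order_tendstoD) (use \<delta> in simp)
  moreover have "\<forall>\<^sub>F u in at_right 0. 0 < h u"
    using rv unfolding regularly_varying_at_0_def by blast
  ultimately have "\<forall>\<^sub>F u in at_right 0. (h (u / \<delta>))\<^sup>2 \<le> 2 * \<delta> * (h u)\<^sup>2"
    by eventually_elim (auto simp: power_divide divide_less_eq)
  then obtain u0 where u0: "0 < u0" "\<And>u. 0 < u \<Longrightarrow> u < u0 \<Longrightarrow> (h (u / \<delta>))\<^sup>2 \<le> 2 * \<delta> * (h u)\<^sup>2"
    by (auto simp: eventually_at_right_field)
  have "(LINT s:{0<..\<epsilon>}|lborel. (h s)\<^sup>2) \<le> 2 * (LINT s:{0<..\<epsilon> * \<delta>}|lborel. (h s)\<^sup>2)"
    if \<epsilon>: "0 < \<epsilon>" "\<epsilon> < min u0 r" for \<epsilon>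
  proof -
    have \<epsilon>\<delta>: "\<epsilon> * \<delta> \<le> \<epsilon>" using \<epsilon> \<delta> by (simp add: mult_left_le)
    have int1: "integrable lborel (\<lambda>s. indicator {0<..\<epsilon>} s * (h s)\<^sup>2)"
      using \<epsilon> by (intro set_integrable_Ioc_mono[OF int]) simp
    have int2: "integrable lborel (\<lambda>s. indicator {0<..\<epsilon> * \<delta>} s * (h s)\<^sup>2)"
      using order_trans[OF \<epsilon>\<delta>, of r] \<epsilon> by (intro set_integrable_Ioc_mono[OF int]) simp
    have "(LINT s|lborel. indicator {0<..\<epsilon>} s * (h s)\<^sup>2) =
        (1 / \<delta>) * (LINT u|lborel. indicator {0<..\<epsilon>} (u / \<delta>) * (h (u / \<delta>))\<^sup>2)"
      using \<delta> by (subst lborel_integral_real_affine[where c = "1 / \<delta>" and t = 0]) auto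
    also have "\<dots> \<le> (1 / \<delta>) * (LINT u|lborel. 2 * \<delta> * (indicator {0<..\<epsilon> * \<delta>} u * (h u)\<^sup>2))"
    proof (intro mult_left_mono integral_mono)
      show "integrable lborel (\<lambda>u. indicator {0<..\<epsilon>} (u / \<delta>) * (h (u / \<delta>))\<^sup>2)"
        using lborel_integrable_real_affine[OF int1, of "1 / \<delta>" 0] \<delta> by simp
      show "indicator {0<..\<epsilon>} (u / \<delta>) * (h (u / \<delta>))\<^sup>2 \<le> 2 * \<delta> * (indicator {0<..\<epsilon> * \<delta>} u * (h u)\<^sup>2)" for u
      proof -
        have "u < u0" if "u \<le> \<epsilon> * \<delta>" using that \<epsilon> \<epsilon>\<delta> by linarith
        with u0(2)[of u] \<delta> show ?thesis by (auto simp: indicator_def field_simps)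
      qed
    qed (use int2 \<delta> in auto)
    also have "\<dots> = 2 * (LINT u|lborel. indicator {0<..\<epsilon> * \<delta>} u * (h u)\<^sup>2)"
      using \<delta> by simp
    finally show ?thesis by (simp add: set_lebesgue_integral_def)
  qed
  then show ?thesis
    using u0(1) r unfolding eventually_at_right_field by (intro exI[of _ "min u0 r"]) auto
qed

text \<open>A zero integral would make \<open>h\<close> vanish almost everywhere near 0, where it is
  positive. The lemma serves to make the Gaussian laws nondegenerate and the speed positive.\<close>

lemma regularly_varying_integral_square_pos:
  fixes h :: "real \<Rightarrow> real"
  assumes rv: "regularly_varying_at_0 \<beta> h" and b: "0 < b"
    and int: "set_integrable lborel {0<..b} (\<lambda>s. (h s)\<^sup>2)"
  shows "0 < (LINT s:{0<..b}|lborel. (h s)\<^sup>2)"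
proof -
  obtain u0 where u0: "0 < u0" "\<And>u. 0 < u \<Longrightarrow> u < u0 \<Longrightarrow> 0 < h u"
    using rv unfolding regularly_varying_at_0_def eventually_at_right_field by blast
  let ?f = "\<lambda>s. indicator {0<..b} s * (h s)\<^sup>2"
  have int: "integrable lborel ?f" using int by (simp add: set_integrable_def)
  have "integral\<^sup>L lborel ?f \<noteq> 0"
  proof
    assume "integral\<^sup>L lborel ?f = 0"
    then have "AE s in lborel. ?f s = 0"
      using integral_nonneg_eq_0_iff_AE[OF int] by simp
    then have "AE s in lborel. s \<notin> {0<..<min b u0}"
      by eventually_elim (use u0(2) in \<open>force simp: indicator_def\<close>)
    then have "{0<..<min b u0} \<in> null_sets lborel"
      by (subst AE_iff_null_sets) auto
    then show False using b u0(1) by (simp add: null_sets_def)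
  qed
  moreover have "0 \<le> integral\<^sup>L lborel ?f" by (intro integral_nonneg_AE) auto
  ultimately have "0 < integral\<^sup>L lborel ?f" by linarith
  then show ?thesis by (simp add: set_lebesgue_integral_def)
qed

text \<open>Dominated convergence. Applied to \<open>h\<^sup>2\<close>, it brings the variance below
  1, as the Gaussian tail bound requires.\<close>

lemma tendsto_integral_Ioc_at_0:
  fixes f :: "real \<Rightarrow> real"
  assumes r: "0 < r" and int: "set_integrable lborel {0<..r} f"
  shows "((\<lambda>b. LINT s:{0<..b}|lborel. f s) \<longlongrightarrow> 0) (at_right 0)"
proof -
  \<comment> \<open>Truncating at \<open>r\<close> gives one integrable majorant for all
    \<open>b\<close> without changing the integral for \<open>b < r\<close>.\<close>
  let ?f = "\<lambda>b s. indicator {0<..min b r} s * f s"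
  have int': "integrable lborel (\<lambda>s. indicator {0<..r} s * f s)"
    using int by (simp add: set_integrable_def)
  have int_f: "integrable lborel (?f b)" for b
    by (rule set_integrable_Ioc_mono[OF int]) simp
  have "((\<lambda>b. LINT s|lborel. ?f b s) \<longlongrightarrow> integral\<^sup>L lborel (\<lambda>s::real. 0)) (at_right 0)"
  proof (rule tendsto_at_right_sequentially[where b = r])
    fix S :: "nat \<Rightarrow> real" assume S: "\<And>n. 0 < S n" "S \<longlonglongrightarrow> 0"
    show "(\<lambda>n. LINT s|lborel. ?f (S n) s) \<longlonglongrightarrow> integral\<^sup>L lborel (\<lambda>s::real. 0)"
    proof (rule integral_dominated_convergence[where w = "\<lambda>s. \<bar>indicator {0<..r} s * f s\<bar>"])
      have "(\<lambda>n. ?f (S n) s) \<longlonglongrightarrow> 0" for s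
      proof (cases "0 < s")
        case True
        have "\<forall>\<^sub>F n in sequentially. S n < s" using S(2) True by (rule order_tendstoD)
        then show ?thesis
          by (intro tendsto_eventually) (auto elim!: eventually_mono)
      qed simp
      then show "AE s in lborel. (\<lambda>n. ?f (S n) s) \<longlonglongrightarrow> 0" by simp
      show "?f (S n) \<in> borel_measurable lborel" for n
        by (rule borel_measurable_integrable[OF int_f])
      show "AE s in lborel. norm (?f (S n) s) \<le> \<bar>indicator {0<..r} s * f s\<bar>" for n
        by (simp add: indicator_def)
      show "integrable lborel (\<lambda>s. \<bar>indicator {0<..r} s * f s\<bar>)"
        using int' by (rule integrable_abs)
    qed simp
  qed (use r in auto)
  moreover have "\<forall>\<^sub>F b in at_right 0. (LINT s|lborel. ?f b s) = (LINT s:{0<..b}|lborel. f s)"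
    unfolding eventually_at_right_field
    using r by (intro exI[of _ r]) (auto simp: set_lebesgue_integral_def min_def)
  ultimately show ?thesis by (auto elim: Lim_transform_eventually)
qed

section \<open>The space of continuous functions\<close>

lemma sets_borel_of: "sets (borel_of E) = sigma_sets (topspace E) {U. openin E U}"
  unfolding borel_of_def by (rule sets_measure_of) (auto dest: openin_subset)

lemma space_borel_of: "space (borel_of E) = topspace E"
  unfolding borel_of_def by (rule space_measure_of) (auto dest: openin_subset)

lemma openin_in_sets_borel_of: "openin E U \<Longrightarrow> U \<in> sets (borel_of E)"
  unfolding sets_borel_of by (intro sigma_sets.Basic) simp

lemma closedin_in_sets_borel_of:
  assumes "closedin E F"
  shows "F \<in> sets (borel_of E)"
proof -
  have "topspace E - (topspace E - F) \<in> sets (borel_of E)"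
    unfolding sets_borel_of
    using assms by (intro sigma_sets.Compl sigma_sets.Basic) (simp add: closedin_def)
  then show ?thesis using closedin_subset[OF assms] by (simp add: double_diff)
qed

text \<open>Points of a \<open>cfunspace\<close> are bounded by definition; compactness of the unit
  interval makes this automatic.\<close>

lemma topspace_C01: "topspace C01 = {f \<in> extensional {0..1}. continuous_on {0..1} f}"
proof -
  have "compactin (top_of_set {0..1::real}) (topspace (top_of_set {0..1}))"
    by (simp add: compactin_subtopology)
  from compactin_mspace_cfunspace[OF this, of "euclidean_metric :: real metric"]
  show ?thesis by (auto simp: continuous_map_iff_continuous)
qed

text \<open>Closed balls are the right ones for the supremum distance: pointwise bounds by
  \<open>r\<close> yield a distance at most \<open>r\<close>, and strict bounds would yield no
  more.\<close>

lemma openin_C01_ball: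
  assumes "openin C01 U" "f \<in> U"
  obtains r where "0 < r"
    "\<And>g. g \<in> topspace C01 \<Longrightarrow> (\<And>t. t \<in> {0..1} \<Longrightarrow> \<bar>f t - g t\<bar> \<le> r) \<Longrightarrow> g \<in> U"
proof -
  let ?m = "cfunspace (top_of_set {0..1::real}) (euclidean_metric :: real metric)"
  interpret C: Metric_space "mspace ?m" "mdist ?m" by (rule Metric_space_mspace_mdist)
  obtain r where r: "0 < r" "C.mcball f r \<subseteq> U"
    using assms unfolding mtopology_of_def C.openin_mtopology_mcball by blast
  have f: "f \<in> mspace ?m"
    using subsetD[OF openin_subset[OF assms(1)] assms(2)] by (simp only: topspace_mtopology_of)
  show ?thesis
  proof (rule that[OF r(1)])
    fix g assume g: "g \<in> topspace C01" "\<And>t. t \<in> {0..1} \<Longrightarrow> \<bar>f t - g t\<bar> \<le> r"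
    have "mdist ?m f g \<le> r"
      by (rule mdist_cfunspace_le) (use r(1) g(2) in \<open>auto simp: dist_real_def\<close>)
    then have "g \<in> C.mcball f r" using f g(1) by (simp add: C.mcball_def del: mspace_cfunspace)
    then show "g \<in> U" using r(2) by blast
  qed
qed

lemma openin_C01_I:
  assumes "U \<subseteq> topspace C01"
    and "\<And>f. f \<in> U \<Longrightarrow> \<exists>r>0. \<forall>g\<in>topspace C01. (\<forall>t\<in>{0..1}. \<bar>f t - g t\<bar> \<le> r) \<longrightarrow> g \<in> U"
  shows "openin C01 U"
proof -
  let ?m = "cfunspace (top_of_set {0..1::real}) (euclidean_metric :: real metric)"
  interpret C: Metric_space "mspace ?m" "mdist ?m" by (rule Metric_space_mspace_mdist)
  have "\<exists>r>0. C.mball f r \<subseteq> U" if "f \<in> U" for f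
  proof -
    obtain r where r: "0 < r" "\<forall>g\<in>topspace C01. (\<forall>t\<in>{0..1}. \<bar>f t - g t\<bar> \<le> r) \<longrightarrow> g \<in> U"
      using assms(2)[OF \<open>f \<in> U\<close>] by blast
    have "g \<in> U" if "g \<in> C.mball f r" for g
    proof -
      have fg: "f \<in> mspace ?m" "g \<in> mspace ?m" "mdist ?m f g \<le> r"
        using that by (simp_all add: C.mball_def del: mspace_cfunspace)
      have "\<bar>f t - g t\<bar> \<le> r" if "t \<in> {0..1}" for t
        using mdist_cfunspace_imp_mdist_le[OF fg] that by (simp add: dist_real_def)
      then show ?thesis using r(2) fg(2) by (simp del: mspace_cfunspace)
    qed
    then show ?thesis using r(1) by blast
  qed
  then show ?thesis
    using assms(1) unfolding mtopology_of_def C.openin_mtopology by (auto simp del: mspace_cfunspace)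
qed

text \<open>Total boundedness suffices. A finite 1/4-net has finitely many continuous centres, hence
  a common \<open>\<delta>\<close> at which they move less than 1/4; two approximation errors of at
  most 1/4 keep the sum below 1.\<close>

lemma compactin_C01_small_increment:
  assumes "compactin C01 K"
  obtains \<delta> where "0 < \<delta>" "\<delta> \<le> 1" "\<And>f. f \<in> K \<Longrightarrow> \<bar>f \<delta> - f 0\<bar> < 1"
proof -
  let ?m = "cfunspace (top_of_set {0..1::real}) (euclidean_metric :: real metric)"
  interpret C: Metric_space "mspace ?m" "mdist ?m" by (rule Metric_space_mspace_mdist)
  have "C.mtotally_bounded K"
    using assms unfolding mtopology_of_def by (rule C.compactin_imp_mtotally_bounded)
  then obtain D where D: "finite D" "D \<subseteq> K" "K \<subseteq> (\<Union>f\<in>D. C.mball f (1/4))"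
    unfolding C.mtotally_bounded_def by (meson divide_pos_pos zero_less_numeral zero_less_one)
  have "\<forall>\<^sub>F t in at_right 0. \<bar>f t - f 0\<bar> < 1/4" if "f \<in> D" for f
  proof -
    have "f \<in> topspace C01" using that D(2) compactin_subset_topspace[OF assms] by blast
    then have "continuous_on {0..1} f" unfolding topspace_C01 by blast
    then have "(f \<longlongrightarrow> f 0) (at 0 within {0..1})" by (simp add: continuous_on_def)
    then have "(f \<longlongrightarrow> f 0) (at_right 0)" by (simp add: at_within_Icc_at_right)
    then have "\<forall>\<^sub>F t in at_right 0. dist (f t) (f 0) < 1/4" by (rule tendstoD) simp
    then show ?thesis by (simp add: dist_real_def)
  qed
  with D(1) have "\<forall>\<^sub>F t in at_right 0. \<forall>f\<in>D. \<bar>f t - f 0\<bar> < 1/4"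
    by (intro eventually_ball_finite) auto
  moreover have "\<forall>\<^sub>F t in at_right (0::real). 0 < t \<and> t \<le> 1"
    unfolding eventually_at_right_field by (intro exI[of _ 1]) auto
  ultimately have "\<forall>\<^sub>F t in at_right 0. (\<forall>f\<in>D. \<bar>f t - f 0\<bar> < 1/4) \<and> 0 < t \<and> t \<le> 1"
    by (rule eventually_conj)
  then obtain \<delta> where \<delta>: "\<And>f. f \<in> D \<Longrightarrow> \<bar>f \<delta> - f 0\<bar> < 1/4" "0 < \<delta>" "\<delta> \<le> 1"
    using eventually_happens'[OF trivial_limit_at_right_real] by blast
  have "\<bar>g \<delta> - g 0\<bar> < 1" if "g \<in> K" for g
  proof -
    obtain f where f: "f \<in> D" "g \<in> C.mball f (1/4)" using D(3) \<open>g \<in> K\<close> by blast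
    then have fg: "f \<in> mspace ?m" "g \<in> mspace ?m" "mdist ?m f g \<le> 1/4"
      by (simp_all add: C.mball_def del: mspace_cfunspace)
    have "\<bar>f t - g t\<bar> \<le> 1/4" if "t \<in> {0..1}" for t
      using mdist_cfunspace_imp_mdist_le[OF fg] that by (simp add: dist_real_def)
    from this[of 0] this[of \<delta>] have "\<bar>f 0 - g 0\<bar> \<le> 1/4" "\<bar>f \<delta> - g \<delta>\<bar> \<le> 1/4"
      using \<delta>(2,3) by auto
    with \<delta>(1)[OF f(1)] show ?thesis by linarith
  qed
  with \<delta>(2,3) show ?thesis by (rule that)
qed

lemma closedin_C01_increment_ge:
  assumes "s \<in> {0..1}" "t \<in> {0..1}"
  shows "closedin C01 {f \<in> topspace C01. c \<le> \<bar>f t - f s\<bar>}" (is "closedin C01 ?F")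
  unfolding closedin_def
proof
  show "openin C01 (topspace C01 - ?F)"
  proof (rule openin_C01_I)
    fix f assume f: "f \<in> topspace C01 - ?F"
    \<comment> \<open>Moving both values by at most \<open>r\<close> changes the increment by at
      most \<open>2 * r\<close>, and a third of the gap remains.\<close>
    define r where "r = (c - \<bar>f t - f s\<bar>) / 3"
    have "0 < r" using f by (auto simp: r_def)
    moreover have "g \<in> topspace C01 - ?F"
      if "g \<in> topspace C01" "\<forall>u\<in>{0..1}. \<bar>f u - g u\<bar> \<le> r" for g
    proof -
      have "\<bar>f t - g t\<bar> \<le> r" "\<bar>f s - g s\<bar> \<le> r" using that(2) assms by auto
      then have "\<bar>g t - g s\<bar> < c" using \<open>0 < r\<close> unfolding r_def by argo
      then show ?thesis using that(1) by (simp del: topspace_mtopology_of)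
    qed
    ultimately show "\<exists>r>0. \<forall>g\<in>topspace C01. (\<forall>t\<in>{0..1}. \<bar>f t - g t\<bar> \<le> r) \<longrightarrow> g \<in> topspace C01 - ?F"
      by blast
  qed blast
qed blast

section \<open>Borel measurability of maps into the path space\<close>

text \<open>Tubes around rational-valued step functions. The bound is non-strict so that it survives
  passage from a dense set of times to its closure; \<open>Suc m\<close> keeps the tolerance
  meaningful at \<open>m = 0\<close>.\<close>

definition step_box :: "nat \<Rightarrow> nat \<Rightarrow> rat list \<Rightarrow> (real \<Rightarrow> real) set" where
  "step_box m n q = {f. \<forall>k<n. \<forall>t\<in>{real k / n..real (Suc k) / n}. \<bar>f t - of_rat (q ! k)\<bar> \<le> 1 / Suc m}"

lemma step_box_diameter:
  assumes "f \<in> step_box m n q" "g \<in> step_box m n q" "0 < n" "t \<in> {0..1}"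
  shows "\<bar>f t - g t\<bar> \<le> 2 / Suc m"
proof -
  obtain k where k: "k < n" "t \<in> {real k / n..real (Suc k) / n}"
  \<comment> \<open>At \<open>t = 1\<close> the floor of \<open>t * n\<close> is \<open>n\<close>,
    which is not a cell index, so the last cell is used.\<close>
  proof (cases "t = 1")
    case True
    then show ?thesis using assms(3) by (intro that[of "n - 1"]) (auto simp: field_simps)
  next
    case False
    let ?k = "nat \<lfloor>t * n\<rfloor>"
    have "t * n < n" "0 \<le> t * n" using False assms(3,4) by auto
    then have "?k < n" "real ?k \<le> t * n" "t * n \<le> real (Suc ?k)" by linarith+
    then show ?thesis using assms(3) by (intro that[of ?k]) (auto simp: field_simps)
  qed
  then have "\<bar>f t - of_rat (q ! k)\<bar> \<le> 1 / Suc m" "\<bar>g t - of_rat (q ! k)\<bar> \<le> 1 / Suc m"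
    using assms(1,2) unfolding step_box_def by blast+
  then show ?thesis by linarith
qed

lemma step_box_cover:
  assumes f: "continuous_on {0..1} f"
  obtains n q where "0 < n" "f \<in> step_box m n q"
proof -
  \<comment> \<open>Half of the tolerance pays for the oscillation of \<open>f\<close> on a cell,
    the other half for the rational approximation of its value at the left endpoint.\<close>
  let ?e = "1 / (2 * Suc m) :: real"
  have e: "0 < ?e" by simp
  have uc: "uniformly_continuous_on {0..1} f"
    using f by (rule compact_uniformly_continuous) simp
  obtain d where d: "0 < d"
    "\<And>s t. s \<in> {0..1} \<Longrightarrow> t \<in> {0..1} \<Longrightarrow> dist t s < d \<Longrightarrow> dist (f t) (f s) < ?e"
    using uniformly_continuous_onE[OF uc e] by metis
  obtain n where n: "0 < n" "1 / real n < d"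
    using real_arch_inverse[of d] d(1) by (auto simp: inverse_eq_divide)
  have "\<exists>r::rat. \<bar>of_rat r - f (real k / n)\<bar> < ?e" for k
  proof -
    obtain q where "f (real k / n) < of_rat q" "of_rat q < f (real k / n) + ?e"
      using of_rat_dense[of "f (real k / n)" "f (real k / n) + ?e"] e by auto
    then show ?thesis by (intro exI[of _ q]) linarith
  qed
  then obtain r :: "nat \<Rightarrow> rat" where r: "\<And>k. \<bar>of_rat (r k) - f (real k / n)\<bar> < ?e" by metis
  have "f \<in> step_box m n (map r [0..<n])"
    unfolding step_box_def
  proof (intro CollectI allI impI ballI)
    fix k t assume k: "k < n" and t: "t \<in> {real k / n..real (Suc k) / n}"
    have "real k / n \<in> {0..1}" using k by (auto simp: field_simps)
    moreover have "t \<in> {0..1}"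
    proof -
      have "real (Suc k) / n \<le> 1" "0 \<le> real k / n" using k by (auto simp: field_simps)
      then show ?thesis using t by (meson atLeastAtMost_iff order_trans)
    qed
    moreover have "dist t (real k / n) < d"
    proof -
      have "real (Suc k) / n = real k / n + 1 / n" by (simp add: add_divide_distrib)
      then show ?thesis using t n(2) by (auto simp: dist_real_def)
    qed
    ultimately have "\<bar>f t - f (real k / n)\<bar> < ?e" using d(2) by (simp add: dist_real_def)
    with r[of k] have "\<bar>f t - of_rat (r k)\<bar> < ?e + ?e" by linarith
    also have "?e + ?e = 1 / Suc m" by (simp add: field_simps)
    finally show "\<bar>f t - of_rat (map r [0..<n] ! k)\<bar> \<le> 1 / Suc m" using k by simp
  qed
  with n(1) show ?thesis by (rule that)
qed

text \<open>The rational points of the open interval have the closed interval as closure, and a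
  non-strict bound on a continuous function extends to closures.\<close>

lemma continuous_abs_le_iff_rational:
  fixes f :: "real \<Rightarrow> real"
  assumes f: "continuous_on {a..b} f" and "a < b"
  shows "(\<forall>t\<in>{a..b}. \<bar>f t - q\<bar> \<le> c) \<longleftrightarrow> (\<forall>t\<in>{a<..<b} \<inter> \<rat>. \<bar>f t - q\<bar> \<le> c)"
proof
  assume r: "\<forall>t\<in>{a<..<b} \<inter> \<rat>. \<bar>f t - q\<bar> \<le> c"
  have cl: "closure ({a<..<b} \<inter> \<rat>) = {a..b}"
    using closure_open_Int_superset[of "{a<..<b}" \<rat>] \<open>a < b\<close> by (simp add: Rats_closure_real)
  show "\<forall>t\<in>{a..b}. \<bar>f t - q\<bar> \<le> c"
  proof
    fix t assume "t \<in> {a..b}"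
    then have "t \<in> closure ({a<..<b} \<inter> \<rat>)" by (simp only: cl)
    then show "\<bar>f t - q\<bar> \<le> c"
    proof (rule continuous_le_on_closure[rotated])
      show "continuous_on (closure ({a<..<b} \<inter> \<rat>)) (\<lambda>t. \<bar>f t - q\<bar>)"
        unfolding cl by (intro continuous_intros f)
    qed (use r in blast)
  qed
qed auto

lemma sets_Collect_Ball_countable:
  assumes "countable I" "\<And>i. i \<in> I \<Longrightarrow> {x \<in> space M. P i x} \<in> sets M"
  shows "{x \<in> space M. \<forall>i\<in>I. P i x} \<in> sets M"
proof -
  have "{x \<in> space M. \<forall>i\<in>I. P i x} = space M - (\<Union>i\<in>I. space M - {x \<in> space M. P i x})"
    by auto
  also have "\<dots> \<in> sets M"
    using assms by (intro sets.Diff sets.top sets.countable_UN'') auto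
  finally show ?thesis .
qed

text \<open>The boxes \<open>step_box m n q\<close> form a countable family, each of them is determined by rational
  times on continuous paths, and every open set is a union of boxes.\<close>
lemma measurable_restrict_C01:
  assumes meas: "\<And>t. t \<in> {0..1} \<Longrightarrow> Y t \<in> borel_measurable M"
    and cont: "\<And>\<omega>. \<omega> \<in> space M \<Longrightarrow> continuous_on {0..1} (\<lambda>t. Y t \<omega>)"
  shows "(\<lambda>\<omega>. restrict (\<lambda>t. Y t \<omega>) {0..1}) \<in> M \<rightarrow>\<^sub>M borel_of C01"
proof -
  define \<Phi> where "\<Phi> = (\<lambda>\<omega>. restrict (\<lambda>t. Y t \<omega>) {0..1})"
  have \<Phi>_cont: "continuous_on {0..1} (\<Phi> \<omega>)" if "\<omega> \<in> space M" for \<omega>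
    using cont[OF that] by (rule continuous_on_eq) (simp add: \<Phi>_def)
  then have \<Phi>_in: "\<Phi> \<omega> \<in> topspace C01" if "\<omega> \<in> space M" for \<omega>
    using that unfolding topspace_C01 by (auto simp: \<Phi>_def)
  have box: "{\<omega> \<in> space M. \<Phi> \<omega> \<in> step_box m n q} \<in> sets M" for m n q
  proof -
    have sub: "{real k / n..real (Suc k) / n} \<subseteq> {0..1}" if "k < n" for k
    proof -
      have "real (Suc k) / n \<le> 1" "0 \<le> real k / n" using that by (auto simp: field_simps)
      then show ?thesis by (meson atLeastatMost_subset_iff)
    qed
    have "\<Phi> \<omega> \<in> step_box m n q \<longleftrightarrow>
        (\<forall>k<n. \<forall>t\<in>{real k / n<..<real (Suc k) / n} \<inter> \<rat>. \<bar>Y t \<omega> - of_rat (q ! k)\<bar> \<le> 1 / Suc m)"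
      if \<omega>: "\<omega> \<in> space M" for \<omega>
    proof -
      have "(\<forall>t\<in>{real k / n..real (Suc k) / n}. \<bar>\<Phi> \<omega> t - of_rat (q ! k)\<bar> \<le> 1 / Suc m) \<longleftrightarrow>
          (\<forall>t\<in>{real k / n<..<real (Suc k) / n} \<inter> \<rat>. \<bar>Y t \<omega> - of_rat (q ! k)\<bar> \<le> 1 / Suc m)"
        if "k < n" for k
      proof -
        have "\<Phi> \<omega> t = Y t \<omega>" if "t \<in> {real k / n<..<real (Suc k) / n} \<inter> \<rat>" for t
          using sub[OF \<open>k < n\<close>] that by (auto simp: \<Phi>_def subset_eq)
        moreover have "continuous_on {real k / n..real (Suc k) / n} (\<Phi> \<omega>)"
          using \<Phi>_cont[OF \<omega>] sub[OF that] by (rule continuous_on_subset)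
        ultimately show ?thesis
          using that by (subst continuous_abs_le_iff_rational) (auto simp: divide_strict_right_mono)
      qed
      then show ?thesis unfolding step_box_def by simp
    qed
    then have "{\<omega> \<in> space M. \<Phi> \<omega> \<in> step_box m n q} = {\<omega> \<in> space M.
        \<forall>k<n. \<forall>t\<in>{real k / n<..<real (Suc k) / n} \<inter> \<rat>. \<bar>Y t \<omega> - of_rat (q ! k)\<bar> \<le> 1 / Suc m}"
      by blast
    also have "\<dots> = {\<omega> \<in> space M.
        \<forall>k\<in>{..<n}. \<forall>t\<in>{real k / n<..<real (Suc k) / n} \<inter> \<rat>. \<bar>Y t \<omega> - of_rat (q ! k)\<bar> \<le> 1 / Suc m}"
      by auto
    also have "\<dots> \<in> sets M"
    proof (intro sets_Collect_Ball_countable)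
      fix k t assume "k \<in> {..<n}" "t \<in> {real k / n<..<real (Suc k) / n} \<inter> \<rat>"
      then have "t \<in> {0..1}" using sub[of k] by (auto simp: subset_eq)
      from meas[OF this] have [measurable]: "Y t \<in> borel_measurable M" .
      show "{\<omega> \<in> space M. \<bar>Y t \<omega> - of_rat (q ! k)\<bar> \<le> 1 / Suc m} \<in> sets M" by measurable
    qed (auto intro: countable_subset[OF _ countable_rat])
    finally show ?thesis .
  qed
  have "\<Phi> -` U \<inter> space M \<in> sets M" if U: "openin C01 U" for U
  proof -
    \<comment> \<open>A box also contains discontinuous functions, so only its trace on the path
      space is required to lie in \<open>U\<close>.\<close>
    define J where "J = {(m, n, q). 0 < n \<and> step_box m n q \<inter> topspace C01 \<subseteq> U}"
    have cover: "\<exists>(m, n, q)\<in>J. f \<in> step_box m n q" if "f \<in> U" for f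
    proof -
      obtain r where r: "0 < r"
        "\<And>g. g \<in> topspace C01 \<Longrightarrow> (\<And>t. t \<in> {0..1} \<Longrightarrow> \<bar>f t - g t\<bar> \<le> r) \<Longrightarrow> g \<in> U"
        using openin_C01_ball[OF U \<open>f \<in> U\<close>] by blast
      obtain m where m: "2 / real (Suc m) \<le> r"
        using reals_Archimedean[of "r / 2"] r(1) by (auto simp: field_simps intro: less_imp_le)
      have "f \<in> topspace C01" using that openin_subset[OF U] by blast
      then have "continuous_on {0..1} f" unfolding topspace_C01 by blast
      then obtain n q where nq: "0 < n" "f \<in> step_box m n q" by (rule step_box_cover)
      have "g \<in> U" if "g \<in> step_box m n q" "g \<in> topspace C01" for g
        using r(2)[OF that(2)] step_box_diameter[OF nq(2) that(1) nq(1)] m by (meson order_trans)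
      then have "(m, n, q) \<in> J" using nq(1) by (auto simp: J_def)
      then show ?thesis using nq(2) by blast
    qed
    have "\<Phi> -` U \<inter> space M = (\<Union>(m, n, q)\<in>J. {\<omega> \<in> space M. \<Phi> \<omega> \<in> step_box m n q})"
      using cover \<Phi>_in by (fastforce simp: J_def)
    also have "\<dots> \<in> sets M"
      by (intro sets.countable_UN'') (auto simp: box)
    finally show ?thesis .
  qed
  then show ?thesis
    unfolding borel_of_def \<Phi>_def[symmetric]
    by (intro measurable_measure_of) (use \<Phi>_in openin_subset in blast)+
qed

section \<open>Small time laws\<close>

text \<open>The rate \<open>R\<close> is fixed before \<open>\<delta>\<close>, so
  \<open>\<delta>\<close> may be chosen in terms of a compact set that itself depends on
  \<open>R\<close>.\<close>

lemma (in prob_space) not_exponentially_tight_C01_not_LDP: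
  assumes meas: "\<forall>\<^sub>F \<epsilon> in at_right 0. \<Phi> \<epsilon> \<in> M \<rightarrow>\<^sub>M borel_of C01"
    and g: "\<forall>\<^sub>F \<epsilon> in at_right 0. 0 < g \<epsilon>"
    and R: "0 < R"
    and lower: "\<And>\<delta>. 0 < \<delta> \<Longrightarrow> \<delta> \<le> 1 \<Longrightarrow> \<forall>\<^sub>F \<epsilon> in at_right 0.
      exp (- (g \<epsilon> * R)) \<le> measure (distr M (borel_of C01) (\<Phi> \<epsilon>)) {f \<in> topspace C01. 1 \<le> \<bar>f \<delta> - f 0\<bar>}"
  shows "\<not> exponentially_tight C01 (\<lambda>\<epsilon>. distr M (borel_of C01) (\<Phi> \<epsilon>)) g"
    and "\<not> satisfies_LDP C01 (\<lambda>\<epsilon>. distr M (borel_of C01) (\<Phi> \<epsilon>)) g"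
proof -
  let ?\<mu> = "\<lambda>\<epsilon>. distr M (borel_of C01) (\<Phi> \<epsilon>)"
  let ?F = "\<lambda>\<delta>. {f \<in> topspace C01. 1 \<le> \<bar>f \<delta> - f 0\<bar>}"
  show "\<not> exponentially_tight C01 ?\<mu> g"
  proof
    assume "exponentially_tight C01 ?\<mu> g"
    then obtain K where K: "compactin C01 K"
      "\<forall>\<^sub>F \<epsilon> in at_right 0. measure (?\<mu> \<epsilon>) (topspace C01 - K) < exp (- (g \<epsilon> * R))"
      using R unfolding exponentially_tight_def by blast
    obtain \<delta> where \<delta>: "0 < \<delta>" "\<delta> \<le> 1" "\<And>f. f \<in> K \<Longrightarrow> \<bar>f \<delta> - f 0\<bar> < 1"
      using compactin_C01_small_increment[OF K(1)] by blast
    have "Hausdorff_space C01"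
      unfolding mtopology_of_def by (intro Metric_space.Hausdorff_space_mtopology Metric_space_mspace_mdist)
    then have "openin C01 (topspace C01 - K)"
      using compactin_imp_closedin[OF _ K(1)] by (intro openin_diff openin_topspace)
    then have sets: "topspace C01 - K \<in> sets (borel_of C01)"
      by (rule openin_in_sets_borel_of)
    have sub: "?F \<delta> \<subseteq> topspace C01 - K" using \<delta>(3) by force
    have "\<forall>\<^sub>F \<epsilon> in at_right (0::real). False"
      using meas lower[OF \<delta>(1,2)] K(2)
    proof eventually_elim
      case (elim \<epsilon>)
      interpret \<mu>: prob_space "?\<mu> \<epsilon>" using elim(1) by (rule prob_space_distr)
      have "measure (?\<mu> \<epsilon>) (?F \<delta>) \<le> measure (?\<mu> \<epsilon>) (topspace C01 - K)"
        using sets by (intro \<mu>.finite_measure_mono sub) simp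
      with elim show False by linarith
    qed
    then show False by simp
  qed
  show "\<not> satisfies_LDP C01 ?\<mu> g"
  proof
    assume "satisfies_LDP C01 ?\<mu> g"
    then obtain I where "LDP_with C01 ?\<mu> g I" unfolding satisfies_LDP_def by blast
    then have rate: "rate_function C01 I"
      and upper: "\<And>F. closedin C01 F \<Longrightarrow>
        Limsup (at_right 0) (\<lambda>\<epsilon>. ereal (1 / g \<epsilon>) * ext_ln (measure (?\<mu> \<epsilon>) F)) \<le> - enn2ereal (INF f\<in>F. I f)"
      unfolding LDP_with_def by blast+
    \<comment> \<open>The level exceeds \<open>R\<close> strictly: an infimum of at most
      \<open>R\<close> need not be attained, but some \<open>f\<close> has
      \<open>I f < R + 1\<close>.\<close>
    have "compactin C01 {f \<in> topspace C01. I f \<le> ennreal (R + 1)}"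
    proof -
      have "0 \<le> R + 1" using R by simp
      with rate show ?thesis unfolding rate_function_def by blast
    qed
    then obtain \<delta> where \<delta>: "0 < \<delta>" "\<delta> \<le> 1"
      "\<And>f. f \<in> topspace C01 \<Longrightarrow> I f \<le> ennreal (R + 1) \<Longrightarrow> \<bar>f \<delta> - f 0\<bar> < 1"
      by (rule compactin_C01_small_increment) auto
    have "\<forall>\<^sub>F \<epsilon> in at_right 0. ereal (- R) \<le> ereal (1 / g \<epsilon>) * ext_ln (measure (?\<mu> \<epsilon>) (?F \<delta>))"
      using g lower[OF \<delta>(1,2)]
    proof eventually_elim
      case (elim \<epsilon>)
      define m where "m = measure (?\<mu> \<epsilon>) (?F \<delta>)"
      have m: "exp (- (g \<epsilon> * R)) \<le> m" using elim by (simp add: m_def)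
      \<comment> \<open>Positivity selects the logarithmic branch of \<open>ext_ln\<close> rather
        than its value at nonpositive arguments.\<close>
      then have "0 < m" by (rule less_le_trans[rotated]) simp
      moreover have "- (g \<epsilon> * R) \<le> ln m" using m \<open>0 < m\<close> by (simp add: ln_ge_iff)
      ultimately show ?case
        using elim(1) unfolding m_def[symmetric] by (simp add: ext_ln_def field_simps)
    qed
    then have "ereal (- R) \<le> Limsup (at_right 0) (\<lambda>\<epsilon>. ereal (1 / g \<epsilon>) * ext_ln (measure (?\<mu> \<epsilon>) (?F \<delta>)))"
      by (intro order_trans[OF Liminf_bounded Liminf_le_Limsup]) simp_all
    also have "\<dots> \<le> - enn2ereal (INF f\<in>?F \<delta>. I f)"
      using \<delta>(1,2) by (intro upper closedin_C01_increment_ge) auto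
    finally have "enn2ereal (INF f\<in>?F \<delta>. I f) \<le> ereal R"
      by (simp add: ereal_uminus_le_reorder flip: uminus_ereal.simps)
    then have "(INF f\<in>?F \<delta>. I f) \<le> ennreal R"
      using R by (simp add: less_eq_ennreal.rep_eq)
    also have "\<dots> < ennreal (R + 1)" using R by (simp add: ennreal_less_iff)
    finally obtain f where f: "f \<in> ?F \<delta>" "I f < ennreal (R + 1)" by (auto simp: INF_less_iff)
    then show False using \<delta>(3)[of f] less_imp_le[OF f(2)] by auto
  qed
qed

theorem theorem5p14:
  fixes M :: "'a measure"
    and B X :: "real \<Rightarrow> 'a \<Rightarrow> real"
    and h H\<^sub>2 :: "real \<Rightarrow> real"
  assumes "prob_space M"
    and "standard_brownian_motion M B"
    and "\<forall>t\<in>{0<..1}. 0 \<le> h t"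
    and "set_borel_measurable lborel {0<..1} h"
    and "set_integrable lborel {0<..1} (\<lambda>s. (h s)\<^sup>2)"
    and "regularly_varying_at_0 (- 1 / 2) h"
    and "antimono_on {0<..1} (\<lambda>t. (h t)\<^sup>2)"
    and "\<forall>t\<in>{0..1}. H\<^sub>2 t = (LINT s:{0<..t}|lborel. (h s)\<^sup>2)"
    and "fernique_condition (\<lambda>t. sqrt (H\<^sub>2 t))"
    and "\<forall>t\<in>{0..1}. is_wiener_integral M B t (\<lambda>s. h (t - s)) (X t)"
    and "\<forall>\<omega>\<in>space M. continuous_on {0..1} (\<lambda>t. X t \<omega>)"
  shows "\<not> exponentially_tight C01 (small_time_law M X) (\<lambda>\<epsilon>. 1 / H\<^sub>2 \<epsilon>)
       \<and> \<not> satisfies_LDP C01 (small_time_law M X) (\<lambda>\<epsilon>. 1 / H\<^sub>2 \<epsilon>)"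
proof -
  note BM = assms(2) and h_meas = assms(4) and h_int = assms(5) and h_rv = assms(6)
  interpret prob_space M by fact
  have X_cont: "continuous_on {0..1} (\<lambda>t. X t \<omega>)" if "\<omega> \<in> space M" for \<omega>
    using assms(11) that by blast
  have X_wiener: "is_wiener_integral M B t (\<lambda>s. h (t - s)) (X t)" if "t \<in> {0..1}" for t
    using assms(10) that by blast
  have X_meas [measurable]: "X t \<in> borel_measurable M" if "t \<in> {0..1}" for t
    using X_wiener[OF that] unfolding is_wiener_integral_def by blast
  have H: "H\<^sub>2 t = (LINT s:{0<..t}|lborel. (h s)\<^sup>2)" if "t \<in> {0..1}" for t
    using assms(8) that by blast
  have H_pos: "0 < H\<^sub>2 t" if "0 < t" "t \<le> 1" for t
    using regularly_varying_integral_square_pos[OF h_rv that(1)] set_integrable_Ioc_mono[OF h_int that(2)] that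
    by (simp add: H set_integrable_def)
  have unit: "\<forall>\<^sub>F \<epsilon> in at_right 0. 0 < \<epsilon> \<and> \<epsilon> < (1::real)"
    unfolding eventually_at_right_field by (intro exI[of _ 1]) auto
  have "\<forall>\<^sub>F \<epsilon> in at_right 0. (LINT s:{0<..\<epsilon>}|lborel. (h s)\<^sup>2) < 1"
    using tendsto_integral_Ioc_at_0[OF _ h_int] by (rule order_tendstoD) simp_all
  with unit have H_le_1: "\<forall>\<^sub>F \<epsilon> in at_right 0. H\<^sub>2 \<epsilon> \<le> 1"
    by eventually_elim (simp add: H)
  \<comment> \<open>On the interval \<open>{0..0}\<close> every admissible triple has both endpoints
    0, so all step integrals vanish and \<open>X 0\<close> is a mean square limit of zeros.\<close>
  have X0: "AE \<omega> in M. X 0 \<omega> = 0"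
  proof -
    have "(\<lambda>k. \<integral>\<^sup>+\<omega>. ennreal ((X 0 \<omega>)\<^sup>2) \<partial>M) \<longlonglongrightarrow> 0" if
      P: "\<And>k. \<forall>(c, a, b)\<in>set (P k). 0 \<le> a \<and> a \<le> b \<and> b \<le> 0" and
      lim: "(\<lambda>k. \<integral>\<^sup>+\<omega>. ennreal ((X 0 \<omega> - step_integral B (P k) \<omega>)\<^sup>2) \<partial>M) \<longlonglongrightarrow> 0" for P
    proof -
      have "step_integral B Q \<omega> = 0" if "\<forall>(c, a, b)\<in>set Q. 0 \<le> a \<and> a \<le> b \<and> b \<le> 0" for Q \<omega>
        using that unfolding step_integral_def
      proof (induction Q)
        case (Cons p Q)
        obtain c a b where p: "p = (c, a, b)" by (cases p) auto
        with Cons.prems have "a = 0" "b = 0" by auto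
        with Cons p show ?case by simp
      qed simp
      from this[OF P] have "step_integral B (P k) \<omega> = 0" for k \<omega> .
      with lim show ?thesis by simp
    qed
    then have "(\<integral>\<^sup>+\<omega>. ennreal ((X 0 \<omega>)\<^sup>2) \<partial>M) = 0"
      using X_wiener[of 0] unfolding is_wiener_integral_def by (auto simp: LIMSEQ_const_iff)
    then have "AE \<omega> in M. ennreal ((X 0 \<omega>)\<^sup>2) = 0"
      by (subst (asm) nn_integral_0_iff_AE) (auto simp: X_meas)
    then show ?thesis by eventually_elim simp
  qed
  \<comment> \<open>For \<open>\<epsilon>\<close> below 1 the times \<open>\<epsilon> * t\<close>
    stay in the unit interval, where \<open>X\<close> is controlled.\<close>
  have meas: "small_time X \<epsilon> \<in> M \<rightarrow>\<^sub>M borel_of C01" if \<epsilon>: "0 < \<epsilon>" "\<epsilon> < 1" for \<epsilon>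
  proof -
    have sub: "\<epsilon> * t \<in> {0..1}" if "t \<in> {0..1}" for t
      using that \<epsilon> by (auto intro: mult_le_one)
    have "continuous_on {0..1} (\<lambda>t. X (\<epsilon> * t) \<omega>)" if "\<omega> \<in> space M" for \<omega>
      by (rule continuous_on_compose2[OF X_cont[OF that]]) (use sub in \<open>auto intro!: continuous_intros\<close>)
    then show ?thesis
      unfolding small_time_def[abs_def] using sub by (intro measurable_restrict_C01 X_meas)
  qed
  \<comment> \<open>The 8 is the tail constant 4 times the factor 2 from slow variation. Only the
    range of admissible \<open>\<epsilon>\<close> depends on \<open>\<delta>\<close>, not this
    constant.\<close>
  have lower: "\<forall>\<^sub>F \<epsilon> in at_right 0. exp (- (1 / H\<^sub>2 \<epsilon> * 8)) \<le>
      measure (distr M (borel_of C01) (small_time X \<epsilon>)) {f \<in> topspace C01. 1 \<le> \<bar>f \<delta> - f 0\<bar>}"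
    if \<delta>: "0 < \<delta>" "\<delta> \<le> 1" for \<delta>
    using unit H_le_1 regularly_varying_integral_square_slowly_varying[OF h_rv \<delta> zero_less_one h_int]
  proof eventually_elim
    case (elim \<epsilon>)
    let ?b = "\<epsilon> * \<delta>"
    have b: "0 < ?b" "?b \<le> \<epsilon>" "?b \<le> 1" using elim(1) \<delta> by (auto simp: mult_le_one mult_left_le)
    have H_slow: "H\<^sub>2 \<epsilon> \<le> 2 * H\<^sub>2 ?b" using elim b by (simp add: H)
    have Hb: "0 < H\<^sub>2 ?b" "0 < H\<^sub>2 \<epsilon>" using H_pos b elim(1) by auto
    \<comment> \<open>Monotonicity of \<open>H\<^sub>2\<close> transfers the bound 1 on the variance
      from \<open>\<epsilon>\<close> to \<open>?b\<close>.\<close>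
    have "(LINT s|lborel. indicator {0<..?b} s * (h s)\<^sup>2) \<le> (LINT s|lborel. indicator {0<..\<epsilon>} s * (h s)\<^sup>2)"
    proof (rule integral_mono)
      show "indicator {0<..?b} s * (h s)\<^sup>2 \<le> indicator {0<..\<epsilon>} s * (h s)\<^sup>2" for s
        using order_trans[OF _ b(2), of s] by (auto simp: indicator_def)
    qed (use b elim(1) in \<open>simp_all add: set_integrable_Ioc_mono[OF h_int]\<close>)
    then have "H\<^sub>2 ?b \<le> H\<^sub>2 \<epsilon>"
      using b elim(1) by (simp add: H set_lebesgue_integral_def)
    with elim(2) have Hb1: "H\<^sub>2 ?b \<le> 1" by linarith
    have char: "char (distr M borel (X ?b)) \<theta> = exp (- (\<theta>\<^sup>2 * H\<^sub>2 ?b) / 2)" for \<theta>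
      using wiener_integral_moving_average_char[OF prob_space_axioms BM _ b(3) X_wiener h_meas h_int] b
      by (simp add: H)
    have F: "{f \<in> topspace C01. 1 \<le> \<bar>f \<delta> - f 0\<bar>} \<in> sets (borel_of C01)"
      using \<delta> by (intro closedin_C01_increment_ge closedin_in_sets_borel_of) auto
    have m: "small_time X \<epsilon> \<in> M \<rightarrow>\<^sub>M borel_of C01" using meas elim(1) by blast
    have "exp (- (1 / H\<^sub>2 \<epsilon> * 8)) \<le> exp (- 4 / H\<^sub>2 ?b)"
      using H_slow Hb by (simp add: field_simps)
    also have "\<dots> \<le> prob {\<omega> \<in> space M. 1 \<le> \<bar>X ?b \<omega>\<bar>}"
      using b by (intro centered_normal_tail_lower_bound X_meas Hb Hb1 char) auto
    also have "\<dots> \<le> prob (small_time X \<epsilon> -` {f \<in> topspace C01. 1 \<le> \<bar>f \<delta> - f 0\<bar>} \<inter> space M)"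
    \<comment> \<open>The path increment is \<open>X ?b - X 0\<close>, and \<open>X 0\<close>
      vanishes only almost surely, so the events are compared up to a null set.\<close>
    proof (rule finite_measure_mono_AE)
      have inC: "small_time X \<epsilon> \<omega> \<in> topspace C01" if "\<omega> \<in> space M" for \<omega>
        using measurable_space[OF m that] by (simp only: space_borel_of)
      have incr: "small_time X \<epsilon> \<omega> \<delta> - small_time X \<epsilon> \<omega> 0 = X ?b \<omega> - X 0 \<omega>" for \<omega>
        using \<delta> by (simp add: small_time_def)
      show "AE \<omega> in M. \<omega> \<in> {\<omega> \<in> space M. 1 \<le> \<bar>X ?b \<omega>\<bar>} \<longrightarrow>
          \<omega> \<in> small_time X \<epsilon> -` {f \<in> topspace C01. 1 \<le> \<bar>f \<delta> - f 0\<bar>} \<inter> space M"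
        by (rule AE_mp[OF X0]) (auto simp: incr inC simp del: topspace_mtopology_of)
    qed (rule measurable_sets[OF m F])
    also have "\<dots> = measure (distr M (borel_of C01) (small_time X \<epsilon>)) {f \<in> topspace C01. 1 \<le> \<bar>f \<delta> - f 0\<bar>}"
      by (rule measure_distr[OF m F, symmetric])
    finally show ?case .
  qed
  have "\<forall>\<^sub>F \<epsilon> in at_right 0. small_time X \<epsilon> \<in> M \<rightarrow>\<^sub>M borel_of C01"
    using unit by eventually_elim (simp add: meas)
  moreover have "\<forall>\<^sub>F \<epsilon> in at_right 0. 0 < 1 / H\<^sub>2 \<epsilon>"
    using unit by eventually_elim (simp add: H_pos)
  ultimately show ?thesis
    unfolding small_time_law_def[abs_def]
    using not_exponentially_tight_C01_not_LDP[where R = 8, OF _ _ _ lower] by simp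
qed

end
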